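(* Assume the NFA Acceptance hypothesis. Then there is a fixed context-free grammar $\Gamma$ such that, for every $\varepsilon>0$, the CFL Reachability problem for $\Gamma$ has no $O(n^{3-\varepsilon})$-time algorithm, where $n$ is the number of vertices of the input graph.
   Context: An NFA is a tuple $M=(Q,\Sigma,\delta,q_0,F)$ with $\delta\subseteq Q\times\Sigma\times Q$, $q_0\in Q$, $F\subseteq Q$ (no $\epsilon$-transitions); $M$ accepts $x\in\Sigma^*$ if there are states $q_1,\dots,q_{|x|}$ with $(q_i,x_{i+1},q_{i+1})\in\delta$ for all $0\le i<|x|$ and $q_{|x|}\in F$. NFA Acceptance: given $M$ and $x$, decide whether $M$ accepts $x$; write $n=|Q|$, $m=|\delta|$, $\ell=|x|$. The NFA Acceptance hypothesis states: for all $\alpha\in[1,2]$ and all $\beta,\varepsilon>0$, there is no (randomized) algorithm solving NFA Acceptance on NFAs with $n$ states, $m=\Theta(n^\alpha)$ transitions, alphabet size $n^{o(1)}$ and strings of length $\ell=\Theta(n^\beta)$ in time $O((m\ell)^{1-\varepsilon})$. A context-free grammar $\Gamma=(N,\Sigma,P,S)$ generates the language $L(\Gamma)\subseteq\Sigma^*$ in the usual way. CFL Reachability for a fixed grammar $\Gamma$: given a directed graph $G=(V,E)$, vertices $s,t\in V$, and an edge labeling $\sigma:E\to\Sigma$, decide whether there is a walk $s=v_0,v_1,\dots,v_k=t$ in $G$ such that $\sigma(v_0,v_1)\sigma(v_1,v_2)\cdots\sigma(v_{k-1},v_k)\in L(\Gamma)$. The grammar is fixed (constant size). *)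

theory Defs
  imports
    "HOL-Probability.Probability"
    "HOL-Library.Landau_Symbols"
    "Graph_Theory.Pair_Digraph"
begin

section \<open>Randomized word RAM\<close>

text \<open>
  Unit-cost random access machine with named registers (each program uses only finitely many)
  and one linear memory, controlled by structured programs. Every word is a natural number below
  a capacity B. A computation that would produce a larger number is stuck, so an algorithm has to
  make sure that this never happens.
\<close>

datatype binop = Add | Sub | Mul | Div | Mod | Lt | Eq | And | Or | Xor | Shl | Shr

fun binop_sem :: "binop \<Rightarrow> nat \<Rightarrow> nat \<Rightarrow> nat" where
  "binop_sem Add x y = x + y"
| "binop_sem Sub x y = x - y"
| "binop_sem Mul x y = x * y"
| "binop_sem Div x y = x div y"
| "binop_sem Mod x y = x mod y"
| "binop_sem Lt x y = of_bool (x < y)"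
| "binop_sem Eq x y = of_bool (x = y)"
| "binop_sem And x y = semiring_bit_operations_class.and x y"
| "binop_sem Or x y = semiring_bit_operations_class.or x y"
| "binop_sem Xor x y = semiring_bit_operations_class.xor x y"
| "binop_sem Shl x y = push_bit y x"
| "binop_sem Shr x y = drop_bit y x"

type_synonym reg = nat

datatype prog =
    Const reg nat
  | Binop binop reg reg reg
  | Load reg reg
  | Store reg reg
  | Flip reg
  | Seq prog prog
  | IfNZ reg prog prog
  | WhileNZ reg prog

record machine =
  regs :: "reg \<Rightarrow> nat"
  mem :: "nat \<Rightarrow> nat"
  coins :: "bool stream"

text \<open>\<open>exec B p s t s'\<close>: with word capacity \<open>B\<close>, program \<open>p\<close> started in
  \<open>s\<close> halts in \<open>s'\<close> after \<open>t\<close> steps.\<close>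

inductive exec :: "nat \<Rightarrow> prog \<Rightarrow> machine \<Rightarrow> nat \<Rightarrow> machine \<Rightarrow> bool" for B :: nat where
  Const: "v < B \<Longrightarrow> exec B (Const r v) s 1 (s\<lparr>regs := (regs s)(r := v)\<rparr>)"
| Binop: "binop_sem f (regs s a) (regs s b) < B \<Longrightarrow>
    exec B (Binop f r a b) s 1
      (s\<lparr>regs := (regs s)(r := binop_sem f (regs s a) (regs s b))\<rparr>)"
| Load: "exec B (Load r a) s 1 (s\<lparr>regs := (regs s)(r := mem s (regs s a))\<rparr>)"
| Store: "exec B (Store a r) s 1 (s\<lparr>mem := (mem s)(regs s a := regs s r)\<rparr>)"
| Flip: "exec B (Flip r) s 1
    (s\<lparr>regs := (regs s)(r := of_bool (shd (coins s))), coins := stl (coins s)\<rparr>)"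
| Seq: "exec B p s t s' \<Longrightarrow> exec B q s' t' s'' \<Longrightarrow> exec B (Seq p q) s (t + t') s''"
| IfTrue: "regs s r \<noteq> 0 \<Longrightarrow> exec B p s t s' \<Longrightarrow> exec B (IfNZ r p q) s (t + 1) s'"
| IfFalse: "regs s r = 0 \<Longrightarrow> exec B q s t s' \<Longrightarrow> exec B (IfNZ r p q) s (t + 1) s'"
| WhileTrue: "regs s r \<noteq> 0 \<Longrightarrow> exec B p s t s' \<Longrightarrow> exec B (WhileNZ r p) s' t' s'' \<Longrightarrow>
    exec B (WhileNZ r p) s (t + t' + 1) s''"
| WhileFalse: "regs s r = 0 \<Longrightarrow> exec B (WhileNZ r p) s 1 s"

inductive_cases exec_elims:
  "exec B (Const r v) s t s'"
  "exec B (Binop f r a b) s t s'"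
  "exec B (Load r a) s t s'"
  "exec B (Store a r) s t s'"
  "exec B (Flip r) s t s'"
  "exec B (Seq p q) s t s'"
  "exec B (IfNZ r p q) s t s'"
  "exec B (WhileNZ r p) s t s'"

lemma exec_deterministic:
  "exec B p s t s' \<Longrightarrow> exec B p s u s'' \<Longrightarrow> t = u \<and> s' = s''"
proof (induction arbitrary: u s'' rule: exec.induct)
  case (Seq p s t s' q t' s'')
  from Seq.prems show ?case by (rule exec_elims(6)) (auto dest!: Seq.IH)
next
  case (IfTrue s r p t s' q)
  from IfTrue.prems IfTrue.hyps(1) show ?case by (elim exec_elims(7)) (auto dest!: IfTrue.IH)
next
  case (IfFalse s r q t s' p)
  from IfFalse.prems IfFalse.hyps(1) show ?case by (elim exec_elims(7)) (auto dest!: IfFalse.IH)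
next
  case (WhileTrue s r p t s' t' s'')
  from WhileTrue.prems show ?case
    by (rule exec_elims(8)) (auto simp: WhileTrue.hyps(1) dest!: WhileTrue.IH)
next
  case (WhileFalse s r p)
  from WhileFalse.prems show ?case by (rule exec_elims(8)) (simp_all add: WhileFalse.hyps)
qed (erule exec_elims(1-5), simp)+

definition initial_machine :: "nat list \<Rightarrow> bool stream \<Rightarrow> machine" where
  "initial_machine w \<omega> =
     \<lparr>regs = (\<lambda>_. 0), mem = (\<lambda>i. if i < length w then w ! i else 0), coins = \<omega>\<rparr>"

text \<open>Words of \<open>O(log N)\<close> bits, with \<open>N\<close> at least the input length and every
  input value.\<close>

definition capacity :: "nat \<Rightarrow> nat list \<Rightarrow> nat" where
  "capacity c w = (2 + length w + Max (set w)) ^ c"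

definition coin_space :: "bool stream measure" where
  "coin_space = stream_space (measure_pmf (pmf_of_set UNIV))"

text \<open>
  An algorithm is a program together with its word-size constant \<open>c\<close>; it answers yes iff
  register 0 is nonzero at the end. The time bound is worst case over the coin flips, and the
  error probability is at most 1/3 on yes- and on no-instances.
\<close>

definition decides_within :: "prog \<Rightarrow> nat \<Rightarrow> nat list \<Rightarrow> bool \<Rightarrow> nat \<Rightarrow> bool" where
  "decides_within p c w answer T \<longleftrightarrow>
     (\<forall>\<omega>. \<exists>t s. exec (capacity c w) p (initial_machine w \<omega>) t s \<and> t \<le> T) \<and>
     measure coin_space
       {\<omega>. \<exists>t s. exec (capacity c w) p (initial_machine w \<omega>) t s \<and>
                 (regs s 0 \<noteq> 0 \<longleftrightarrow> answer)} \<ge> 2 / 3"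

text \<open>A decision problem gives, for each value \<open>n\<close> of the size parameter, the encoded
  instances of that size paired with their correct answers.\<close>

type_synonym problem = "nat \<Rightarrow> (nat list \<times> bool) set"

definition solves_in_time :: "prog \<Rightarrow> nat \<Rightarrow> problem \<Rightarrow> (nat \<Rightarrow> real) \<Rightarrow> bool" where
  "solves_in_time p c X f \<longleftrightarrow>
     (\<exists>T :: nat \<Rightarrow> nat. (\<lambda>n. real (T n)) \<in> O(f) \<and>
        (\<forall>n. \<forall>(w, answer) \<in> X n. decides_within p c w answer (T n)))"


section \<open>NFA Acceptance\<close>

record ('q, 'a) nfa =
  states :: "'q set"
  alphabet :: "'a set"
  transitions :: "('q \<times> 'a \<times> 'q) set"
  initial :: 'q
  final :: "'q set"

definition wf_nfa :: "('q, 'a) nfa \<Rightarrow> bool" where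
  "wf_nfa M \<longleftrightarrow> finite (states M) \<and> finite (alphabet M) \<and>
     transitions M \<subseteq> states M \<times> alphabet M \<times> states M \<and>
     initial M \<in> states M \<and> final M \<subseteq> states M"

definition accepts :: "('q, 'a) nfa \<Rightarrow> 'a list \<Rightarrow> bool" where
  "accepts M x \<longleftrightarrow>
     (\<exists>q :: nat \<Rightarrow> 'q. q 0 = initial M \<and>
        (\<forall>i < length x. (q i, x ! i, q (Suc i)) \<in> transitions M) \<and>
        q (length x) \<in> final M)"

text \<open>The transitions may be listed in any order; the accepting states are given by a bit
  vector.\<close>

definition nfa_encoding :: "(nat, nat) nfa \<Rightarrow> nat list \<Rightarrow> nat list \<Rightarrow> bool" where
  "nfa_encoding M x w \<longleftrightarrow>
     (\<exists>ds. distinct ds \<and> set ds = transitions M \<and>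
        w = [card (states M), card (alphabet M), initial M, length ds, length x]
            @ concat (map (\<lambda>(q, a, q'). [q, a, q']) ds)
            @ map (\<lambda>q. of_bool (q \<in> final M)) [0..<card (states M)]
            @ x)"

text \<open>NFA Acceptance on NFAs with \<open>n\<close> states, \<open>m n\<close> transitions, \<open>k n\<close>
  letters and strings of length \<open>l n\<close>.\<close>

definition nfa_acceptance :: "(nat \<Rightarrow> nat) \<Rightarrow> (nat \<Rightarrow> nat) \<Rightarrow> (nat \<Rightarrow> nat) \<Rightarrow> problem" where
  "nfa_acceptance m k l n =
     {(w, accepts M x) | M x w.
        wf_nfa M \<and> states M = {..<n} \<and> alphabet M = {..<k n} \<and>
        card (transitions M) = m n \<and> x \<in> lists (alphabet M) \<and> length x = l n \<and>
        nfa_encoding M x w}"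

text \<open>
  The implicit constants of the \<open>\<Theta>\<close>-bounds and the \<open>n\<^sup>o\<^sup>(\<^sup>1\<^sup>)\<close> alphabet bound range over all
  possibilities after the algorithm has been chosen: the algorithm ruled out by the hypothesis
  has to work for each of them. (For particular choices, such as a one-letter alphabet or more
  transitions than exist, the problem is easier.)
\<close>

definition nfa_acceptance_hypothesis :: bool where
  "nfa_acceptance_hypothesis \<longleftrightarrow>
     (\<forall>\<alpha> \<beta> \<epsilon> :: real. 1 \<le> \<alpha> \<and> \<alpha> \<le> 2 \<and> \<beta> > 0 \<and> \<epsilon> > 0 \<longrightarrow>
        \<not> (\<exists>p c. \<forall>m k l :: nat \<Rightarrow> nat.
              (\<lambda>n. real (m n)) \<in> \<Theta>(\<lambda>n. real n powr \<alpha>) \<and>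
              (\<lambda>n. real (l n)) \<in> \<Theta>(\<lambda>n. real n powr \<beta>) \<and>
              (\<exists>h \<in> o(\<lambda>_. 1). \<forall>\<^sub>F n in at_top. real (k n) = real n powr h n) \<longrightarrow>
              solves_in_time p c (nfa_acceptance m k l)
                (\<lambda>n. (real (m n) * real (l n)) powr (1 - \<epsilon>))))"


section \<open>Context-free grammars and CFL Reachability\<close>

datatype ('v, 't) symbol = NT 'v | TM 't

record ('v, 't) cfg =
  nonterminals :: "'v set"
  terminals :: "'t set"
  productions :: "('v \<times> ('v, 't) symbol list) set"
  start :: 'v

definition wf_cfg :: "('v, 't) cfg \<Rightarrow> bool" where
  "wf_cfg \<Gamma> \<longleftrightarrow> finite (nonterminals \<Gamma>) \<and> finite (terminals \<Gamma>) \<and> finite (productions \<Gamma>) \<and>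
     productions \<Gamma> \<subseteq> nonterminals \<Gamma> \<times> lists (NT ` nonterminals \<Gamma> \<union> TM ` terminals \<Gamma>) \<and>
     start \<Gamma> \<in> nonterminals \<Gamma>"

definition derives1 :: "('v, 't) cfg \<Rightarrow> ('v, 't) symbol list \<Rightarrow> ('v, 't) symbol list \<Rightarrow> bool" where
  "derives1 \<Gamma> u v \<longleftrightarrow>
     (\<exists>A \<gamma> x y. (A, \<gamma>) \<in> productions \<Gamma> \<and> u = x @ [NT A] @ y \<and> v = x @ \<gamma> @ y)"

definition language :: "('v, 't) cfg \<Rightarrow> 't list set" where
  "language \<Gamma> = {w. (derives1 \<Gamma>)\<^sup>*\<^sup>* [NT (start \<Gamma>)] (map TM w)}"

definition cfl_reachable ::
  "('v, 't) cfg \<Rightarrow> 'a pair_pre_digraph \<Rightarrow> ('a \<times> 'a \<Rightarrow> 't) \<Rightarrow> 'a \<Rightarrow> 'a \<Rightarrow> bool" where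
  "cfl_reachable \<Gamma> G \<sigma> s t \<longleftrightarrow>
     (\<exists>p. pre_digraph.awalk (with_proj G) s p t \<and> map \<sigma> p \<in> language \<Gamma>)"

definition cfl_encoding ::
  "nat pair_pre_digraph \<Rightarrow> (nat \<times> nat \<Rightarrow> nat) \<Rightarrow> nat \<Rightarrow> nat \<Rightarrow> nat list \<Rightarrow> bool" where
  "cfl_encoding G \<sigma> s t w \<longleftrightarrow>
     (\<exists>es. distinct es \<and> set es = parcs G \<and>
        w = [card (pverts G), length es, s, t]
            @ concat (map (\<lambda>(u, v). [u, v, \<sigma> (u, v)]) es))"

text \<open>CFL Reachability for \<open>\<Gamma>\<close> on digraphs with \<open>n\<close> vertices.\<close>

definition cfl_reachability :: "(nat, nat) cfg \<Rightarrow> problem" where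
  "cfl_reachability \<Gamma> n =
     {(w, cfl_reachable \<Gamma> G \<sigma> s t) | G \<sigma> s t w.
        pair_fin_digraph G \<and> pverts G = {..<n} \<and> s \<in> pverts G \<and> t \<in> pverts G \<and>
        \<sigma> ` parcs G \<subseteq> terminals \<Gamma> \<and> cfl_encoding G \<sigma> s t w}"

end

theory Submission
  imports Defs
begin

text \<open>
  NFA Acceptance with \<open>m = \<Theta>(n\<^sup>2)\<close> and \<open>\<ell> = \<Theta>(n)\<close> reduces to CFL Reachability for
  palindromes with a marked centre. Letters are written in unary, so that the alphabet of the graph
  is fixed. The walk first follows a run of the NFA, passes the centre at an accepting state, and
  then has to read the string backwards along a path; the palindrome condition says that the NFA
  has read exactly this string. With an alphabet of size \<open>n\<^sup>o\<^sup>(\<^sup>1\<^sup>)\<close> the graph has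
  \<open>n\<^sup>1\<^sup>+\<^sup>o\<^sup>(\<^sup>1\<^sup>)\<close> vertices, so a subcubic algorithm would decide NFA Acceptance in
  time \<open>O((m\<ell>)\<^sup>1\<^sup>-\<^sup>\<epsilon>)\<close>. The graph is written by a word RAM program in time linear in
  the sizes of input and output.
\<close>

section \<open>Labelled walks\<close>

text \<open>With \<alpha> = 2 and \<beta> = 1, the product \<open>m * l\<close> is cubic in
  \<open>n\<close> while \<open>n + l\<close> stays linear, so a subcubic bound in the number of
  gadgets beats \<open>m * l\<close>. Two obstacles shape the construction. First, an arc is a pair
  of vertices and carries one label, so transitions between the same two states on different letters
  must not become parallel arcs: each letter leaves from its own vertex, and the ones on the way
  there spell the letter. Second, the given algorithm expects a fresh machine: the reduction has to
  hand over exactly the initial machine of the new instance, which starts at address 0, where the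
  input lies. Hence the rewriting of the input, the cleared registers and the untouched coins.
  Malformed words before the centre are harmless, because the string side admits a single
  word.\<close>

fun lwalk :: "('q \<times> 'a \<times> 'q) set \<Rightarrow> 'q \<Rightarrow> 'a list \<Rightarrow> 'q \<Rightarrow> bool" where
  "lwalk D u [] v \<longleftrightarrow> u = v"
| "lwalk D u (a # as) v \<longleftrightarrow> (\<exists>w. (u, a, w) \<in> D \<and> lwalk D w as v)"

lemma lwalk_append: "lwalk D u (as @ bs) v \<longleftrightarrow> (\<exists>w. lwalk D u as w \<and> lwalk D w bs v)"
  by (induction as arbitrary: u) auto

lemma lwalk_iff_seq:
  "lwalk D u as v \<longleftrightarrow>
     (\<exists>q :: nat \<Rightarrow> 'q. q 0 = u \<and> (\<forall>i < length as. (q i, as ! i, q (Suc i)) \<in> D) \<and> q (length as) = v)"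
proof (induction as arbitrary: u)
  case (Cons a as)
  show ?case
  proof
    assume "lwalk D u (a # as) v"
    then obtain w where w: "(u, a, w) \<in> D" "lwalk D w as v" by auto
    then obtain q where "q 0 = w" "\<forall>i < length as. (q i, as ! i, q (Suc i)) \<in> D" "q (length as) = v"
      using Cons.IH by blast
    with w show "\<exists>q. q 0 = u \<and> (\<forall>i < length (a # as). (q i, (a # as) ! i, q (Suc i)) \<in> D) \<and>
        q (length (a # as)) = v"
      by (intro exI[of _ "case_nat u q"]) (auto simp: nth_Cons split: nat.splits)
  next
    assume "\<exists>q. q 0 = u \<and> (\<forall>i < length (a # as). (q i, (a # as) ! i, q (Suc i)) \<in> D) \<and>
        q (length (a # as)) = v"
    then obtain q where q: "q 0 = u" "\<forall>i < length (a # as). (q i, (a # as) ! i, q (Suc i)) \<in> D"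
        "q (length (a # as)) = v"
      by blast
    have "(u, a, q 1) \<in> D" using q(1) q(2)[rule_format, of 0] by simp
    moreover have "lwalk D (q 1) as v"
      unfolding Cons.IH using q(2,3) by (intro exI[of _ "\<lambda>i. q (Suc i)"]) auto
    ultimately show "lwalk D u (a # as) v" by auto
  qed
qed auto

lemma accepts_iff_lwalk:
  "accepts M x \<longleftrightarrow> (\<exists>f \<in> final M. lwalk (transitions M) (initial M) x f)"
  unfolding accepts_def lwalk_iff_seq by blast

text \<open>Passing to labelled triples puts graph walks and NFA runs under one relation. The
  premise on \<open>s\<close> is for the empty walk, which exists only at a vertex.\<close>

lemma cfl_reachable_iff_lwalk:
  assumes "pair_wf_digraph G" "s \<in> pverts G"
  shows "cfl_reachable \<Gamma> G \<sigma> s t \<longleftrightarrow>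
    (\<exists>z \<in> language \<Gamma>. lwalk {(u, \<sigma> (u, v), v) | u v. (u, v) \<in> parcs G} s z t)"
proof -
  interpret pair_wf_digraph G by fact
  let ?D = "{(u, \<sigma> (u, v), v) | u v. (u, v) \<in> parcs G}"
  have "lwalk ?D u z t \<longleftrightarrow> (\<exists>p. set p \<subseteq> parcs G \<and> pcas u p t \<and> map \<sigma> p = z)" for u z
  proof (induction z arbitrary: u)
    case (Cons a z)
    show ?case
    proof
      assume "lwalk ?D u (a # z) t"
      then obtain w p where "(u, w) \<in> parcs G" "a = \<sigma> (u, w)" "set p \<subseteq> parcs G" "pcas w p t" "map \<sigma> p = z"
        using Cons.IH by auto
      then show "\<exists>p. set p \<subseteq> parcs G \<and> pcas u p t \<and> map \<sigma> p = a # z"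
        by (intro exI[of _ "(u, w) # p"]) auto
    next
      assume "\<exists>p. set p \<subseteq> parcs G \<and> pcas u p t \<and> map \<sigma> p = a # z"
      then obtain e p where "e \<in> parcs G" "fst e = u" "a = \<sigma> e" "set p \<subseteq> parcs G" "pcas (snd e) p t" "map \<sigma> p = z"
        by (auto simp: Cons_eq_map_conv)
      then show "lwalk ?D u (a # z) t"
        using Cons.IH by (cases e) auto
    qed
  qed auto
  then show ?thesis
    unfolding cfl_reachable_def awalk_def using assms(2) by auto
qed


section \<open>Palindromes with a centre\<close>

text \<open>Arc labels have to be terminals, so the dead label 0 is one, although no derivable word
  contains it.\<close>

definition palindrome_cfg :: "(nat, nat) cfg" where
  "palindrome_cfg =
     \<lparr>nonterminals = {0}, terminals = {0, 1, 2, 3},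
      productions = {(0, [TM 1]), (0, [TM 2, NT 0, TM 2]), (0, [TM 3, NT 0, TM 3])}, start = 0\<rparr>"

lemma wf_palindrome_cfg: "wf_cfg palindrome_cfg"
  by (auto simp: wf_cfg_def palindrome_cfg_def)

lemma terminals_palindrome_cfg [simp]: "terminals palindrome_cfg = {0, 1, 2, 3}"
  by (simp add: palindrome_cfg_def)

text \<open>The grammar is linear with mirrored right-hand sides: at most one nonterminal is
  present, and the parts on its two sides stay mirror images.\<close>

lemma palindrome_sentential_form:
  assumes "(derives1 palindrome_cfg)\<^sup>*\<^sup>* [NT 0] v"
  shows "\<exists>u \<in> lists {2, 3}. v = map TM u @ [NT 0] @ map TM (rev u) \<or> v = map TM (u @ [1] @ rev u)"
  using assms
proof (induction rule: rtranclp_induct)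
  case base
  show ?case by (intro bexI[of _ "[]"]) auto
next
  case (step v w)
  obtain A \<gamma> x y where d: "(A, \<gamma>) \<in> productions palindrome_cfg" "v = x @ [NT A] @ y" "w = x @ \<gamma> @ y"
    using step.hyps(2) unfolding derives1_def by blast
  obtain u where u: "u \<in> lists {2, 3}"
      "v = map TM u @ [NT 0] @ map TM (rev u) \<or> v = map TM (u @ [1] @ rev u)"
    using step.IH by blast
  have "NT A \<in> set v" using d by simp
  with u have v: "v = map TM u @ [NT 0] @ map TM (rev u)" by auto
  \<comment> \<open>All other symbols of \<open>v\<close> are terminals, so the rewritten
    nonterminal can only be the middle one.\<close>
  have "x = map TM u \<and> NT A = NT 0 \<and> y = map TM (rev u)"
    using d(2) unfolding v by (auto simp: append_eq_Cons_conv append_eq_append_conv2 Cons_eq_append_conv map_eq_append_conv append_eq_map_conv)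
  then have w: "w = map TM u @ \<gamma> @ map TM (rev u)" using d(3) by simp
  from d(1) consider "\<gamma> = [TM 1]" | a where "a \<in> {2, 3}" "\<gamma> = [TM a, NT 0, TM a]"
    by (auto simp: palindrome_cfg_def)
  then show ?case
  proof cases
    case 1
    then show ?thesis using u(1) w by (intro bexI[of _ u]) auto
  next
    case (2 a)
    then show ?thesis using u(1) w by (intro bexI[of _ "u @ [a]"]) auto
  qed
qed

lemma derives_palindrome:
  assumes "u \<in> lists {2, 3}"
  shows "(derives1 palindrome_cfg)\<^sup>*\<^sup>* [NT 0] (map TM u @ [NT 0] @ map TM (rev u))"
  using assms
proof (induction u rule: rev_induct)
  case (snoc a u)
  have "derives1 palindrome_cfg (map TM u @ [NT 0] @ map TM (rev u))
     (map TM u @ [TM a, NT 0, TM a] @ map TM (rev u))"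
    using snoc.prems unfolding derives1_def
    by (intro exI[of _ 0] exI[of _ "[TM a, NT 0, TM a]"] exI[of _ "map TM u"] exI[of _ "map TM (rev u)"])
      (auto simp: palindrome_cfg_def)
  with snoc show ?case by (simp add: rtranclp.rtrancl_into_rtrancl)
qed simp

lemma language_palindrome_cfg:
  "language palindrome_cfg = (\<lambda>u. u @ [1] @ rev u) ` lists {2, 3}"
proof (intro equalityI subsetI)
  fix z assume "z \<in> language palindrome_cfg"
  then have "(derives1 palindrome_cfg)\<^sup>*\<^sup>* [NT 0] (map TM z)"
    by (simp add: language_def palindrome_cfg_def)
  then obtain u :: "nat list" where u: "u \<in> lists {2, 3}" "map TM z = map TM u @ [NT (0::nat)] @ map TM (rev u) \<or>
      map TM z = (map TM (u @ [1] @ rev u) :: (nat, nat) symbol list)"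
    using palindrome_sentential_form by blast
  have "NT 0 \<notin> set (map TM z :: (nat, nat) symbol list)" by auto
  with u(2) have "map TM z = (map TM (u @ [1] @ rev u) :: (nat, nat) symbol list)"
    by (metis append_Cons in_set_conv_decomp)
  then have "z = u @ [1] @ rev u" by (subst (asm) inj_map_eq_map) (auto simp: inj_def)
  with u(1) show "z \<in> (\<lambda>u. u @ [1] @ rev u) ` lists {2, 3}" by blast
next
  fix z :: "nat list" assume "z \<in> (\<lambda>u. u @ [1] @ rev u) ` lists {2, 3}"
  then obtain u where u: "u \<in> lists {2, 3}" "z = u @ [1] @ rev u" by blast
  have "derives1 palindrome_cfg (map TM u @ [NT 0] @ map TM (rev u)) (map TM u @ [TM 1] @ map TM (rev u))"
    unfolding derives1_def
    by (intro exI[of _ 0] exI[of _ "[TM 1]"] exI[of _ "map TM u"] exI[of _ "map TM (rev u)"])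
      (auto simp: palindrome_cfg_def)
  with derives_palindrome[OF u(1)]
  have "(derives1 palindrome_cfg)\<^sup>*\<^sup>* [NT 0] (map TM (u @ [1] @ rev u))"
    by (simp add: rtranclp.rtrancl_into_rtrancl)
  then show "z \<in> language palindrome_cfg"
    by (simp add: u(2) language_def palindrome_cfg_def)
qed


section \<open>The graph of an NFA and a string\<close>

text \<open>Uniqueness of base \<open>K\<close> notation: a vertex determines its gadget and its
  offset. Most disjointness claims about arcs come down to this.\<close>

lemma mult_add_eq_iff:
  fixes g h b c K :: nat
  assumes "b < K" "c < K"
  shows "g * K + b = h * K + c \<longleftrightarrow> g = h \<and> b = c"
proof
  assume *: "g * K + b = h * K + c"
  have "(g * K + b) div K = g" "(h * K + c) div K = h" using assms by auto
  with * show "g = h \<and> b = c" by auto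
qed simp

lemma distinct_append4:
  assumes "distinct (map f xs)" "distinct (map g ys)" "distinct (map h zs)" "distinct (map i es)"
    and "\<And>a b. a \<in> set xs \<Longrightarrow> b \<in> set ys \<Longrightarrow> f a \<noteq> g b" "\<And>a c. a \<in> set xs \<Longrightarrow> c \<in> set zs \<Longrightarrow> f a \<noteq> h c"
      "\<And>a d. a \<in> set xs \<Longrightarrow> d \<in> set es \<Longrightarrow> f a \<noteq> i d" "\<And>b c. b \<in> set ys \<Longrightarrow> c \<in> set zs \<Longrightarrow> g b \<noteq> h c"
      "\<And>b d. b \<in> set ys \<Longrightarrow> d \<in> set es \<Longrightarrow> g b \<noteq> i d" "\<And>c d. c \<in> set zs \<Longrightarrow> d \<in> set es \<Longrightarrow> h c \<noteq> i d"
  shows "distinct (map f xs @ map g ys @ map h zs @ map i es)"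
  using assms by force

locale nfa_instance =
  fixes M :: "(nat, nat) nfa" and ds :: "(nat \<times> nat \<times> nat) list" and x :: "nat list"
    and n k :: nat
  assumes wf: "wf_nfa M" and states: "states M = {..<n}" and alphabet: "alphabet M = {..<k}"
    and x: "x \<in> lists (alphabet M)"
    and ds: "distinct ds" "set ds = transitions M"
begin

text \<open>
  Every state \<open>q < n\<close> and every string position \<open>i \<le> length x\<close> owns a gadget, a chain of \<open>K\<close>
  vertices starting at \<open>q * K\<close> or \<open>(n + i) * K\<close>, along which ones are read. Labels: 0 is dead (it
  occurs in no production), 1 is the centre, 2 a unary one and 3 the end of a letter. A state gadget
  is left for the letter \<open>a\<close> at offset \<open>a\<close>; a position gadget is left at its last vertex only and
  entered \<open>x ! i\<close> steps before it. Non-accepting states and the gaps between gadgets receive dead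
  arcs, so that the number of arcs does not depend on the instance data.
\<close>

definition K :: nat where "K = k + 2"
definition V :: nat where "V = (n + length x + 1) * K"

definition tr_arc :: "nat \<times> nat \<times> nat \<Rightarrow> nat \<times> nat \<times> nat" where
  "tr_arc = (\<lambda>(q, a, q'). (q * K + a, 3, q' * K))"
definition fin_arc :: "nat \<Rightarrow> nat \<times> nat \<times> nat" where
  "fin_arc q = (q * K, of_bool (q \<in> final M), V - 1)"
definition str_arc :: "nat \<Rightarrow> nat \<times> nat \<times> nat" where
  "str_arc i = ((n + Suc i) * K + (k + 1), 3, (n + i) * K + (k + 1 - x ! i))"
definition chain_arc :: "nat \<Rightarrow> nat \<times> nat \<times> nat" where
  "chain_arc v = (v, if Suc v mod K = 0 then 0 else 2, Suc v)"

definition arc_list :: "(nat \<times> nat \<times> nat) list" where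
  "arc_list = map tr_arc ds @ map fin_arc [0..<n] @ map str_arc [0..<length x] @
     map chain_arc [0..<V - 1]"

abbreviation D :: "(nat \<times> nat \<times> nat) set" where "D \<equiv> set arc_list"

lemma transitions_bound:
  assumes "(q, a, q') \<in> transitions M" shows "q < n" "a < k" "q' < n"
  using assms wf states alphabet by (auto simp: wf_nfa_def)

lemma final_bound: "q \<in> final M \<Longrightarrow> q < n"
  using wf states by (auto simp: wf_nfa_def)

lemma initial_bound: "initial M < n"
  using wf states by (auto simp: wf_nfa_def)

lemma letter_bound: "i < length x \<Longrightarrow> x ! i < k"
  using x alphabet by (metis in_listsD lessThan_iff nth_mem)

lemma K_gt: "k + 1 < K" "0 < K"
  by (auto simp: K_def)

lemmas decode = mult_add_eq_iff[of _ K]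

lemma last_vertex: "V - 1 = (n + length x) * K + (k + 1)"
  by (simp add: V_def K_def)

lemma gadget_less: "g < h \<Longrightarrow> b < K \<Longrightarrow> g * K + b < h * K"
proof -
  assume "g < h" "b < K"
  then have "g * K + b < Suc g * K" by simp
  also have "\<dots> \<le> h * K" using \<open>g < h\<close> by (intro mult_right_mono) auto
  finally show ?thesis .
qed

section \<open>Arcs by label and gadget\<close>

lemma D_iff:
  "(u, a, v) \<in> D \<longleftrightarrow>
     (\<exists>q b q'. (q, b, q') \<in> transitions M \<and> u = q * K + b \<and> a = 3 \<and> v = q' * K) \<or>
     (\<exists>q < n. u = q * K \<and> a = of_bool (q \<in> final M) \<and> v = V - 1) \<or>
     (\<exists>i < length x. u = (n + Suc i) * K + (k + 1) \<and> a = 3 \<and> v = (n + i) * K + (k + 1 - x ! i)) \<or>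
     (u < V - 1 \<and> a = (if Suc u mod K = 0 then 0 else 2) \<and> v = Suc u)"
  unfolding arc_list_def tr_arc_def fin_arc_def str_arc_def chain_arc_def
  by (auto simp: ds(2) image_iff intro: bexI)

lemma D_one: "(u, Suc 0, v) \<in> D \<longleftrightarrow> (\<exists>q \<in> final M. u = q * K \<and> v = V - 1)"
  unfolding D_iff by (auto dest: final_bound)

lemma D_two: "(u, 2, v) \<in> D \<longleftrightarrow> u < V - 1 \<and> Suc u mod K \<noteq> 0 \<and> v = Suc u"
  unfolding D_iff by (auto simp: of_bool_def split: if_splits)

text \<open>The chain arc out of the last vertex of a gadget is dead or, at \<open>V - 1\<close>,
  missing, so ones never lead into the next gadget.\<close>

lemma D_two_gadget:
  assumes "b < K" "g \<le> n + length x"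
  shows "(g * K + b, 2, v) \<in> D \<longleftrightarrow> b < k + 1 \<and> v = g * K + Suc b"
proof -
  have "Suc (g * K + b) mod K = Suc b mod K"
    by (metis add_Suc_right mod_mult_self3)
  then have "Suc (g * K + b) mod K \<noteq> 0 \<longleftrightarrow> b < k + 1"
    using assms(1) by (auto simp: K_def mod_Suc)
  moreover have "g * K + b < V - 1" if "b < k + 1"
  proof -
    have "g * K \<le> (n + length x) * K" using assms(2) by (intro mult_right_mono) auto
    with that show ?thesis unfolding last_vertex by linarith
  qed
  ultimately show ?thesis unfolding D_two by auto
qed

lemma D_three_nfa:
  assumes "q < n" "b < K"
  shows "(q * K + b, 3, v) \<in> D \<longleftrightarrow> (\<exists>q'. (q, b, q') \<in> transitions M \<and> v = q' * K)"
proof -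
  have "q * K + b \<noteq> (n + Suc i) * K + (k + 1)" for i
    using assms K_gt by (subst decode) auto
  moreover have "q * K + b = p * K + c \<longleftrightarrow> q = p \<and> b = c" if "(p, c, p') \<in> transitions M" for p c p'
    using assms(2) transitions_bound[OF that] by (intro decode) (auto simp: K_def)
  then have "(\<exists>p c p'. (p, c, p') \<in> transitions M \<and> q * K + b = p * K + c \<and> v = p' * K) \<longleftrightarrow>
      (\<exists>q'. (q, b, q') \<in> transitions M \<and> v = q' * K)"
    by metis
  ultimately show ?thesis
    unfolding D_iff by (auto simp: of_bool_def simp del: mult_Suc split: if_splits)
qed

text \<open>For \<open>i = 0\<close> there is no such arc: the target of the walk, the last vertex
  of gadget \<open>n\<close>, can be left by a dead arc at most.\<close>

lemma D_three_string:
  assumes "i \<le> length x" "b < K"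
  shows "((n + i) * K + b, 3, v) \<in> D \<longleftrightarrow>
    b = k + 1 \<and> (\<exists>j. i = Suc j \<and> v = (n + j) * K + (k + 1 - x ! j))"
proof -
  have "(n + i) * K + b \<noteq> p * K + c" if "(p, c, p') \<in> transitions M" for p c p'
    using assms transitions_bound[OF that] K_gt by (subst decode) auto
  moreover have "(n + i) * K + b = (n + Suc j) * K + (k + 1) \<longleftrightarrow> i = Suc j \<and> b = k + 1" for j
    using assms K_gt by (subst decode) auto
  ultimately show ?thesis
    unfolding D_iff using assms(1) by (auto simp: of_bool_def split: if_splits)
qed

section \<open>Unary words and the walks that read them\<close>

definition enc :: "nat list \<Rightarrow> nat list" where
  "enc y = concat (map (\<lambda>a. replicate a 2 @ [3]) y)"

lemma enc_in_lists: "enc y \<in> lists {2, 3}"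
  by (auto simp: enc_def split: if_splits)

lemma lwalk_ones:
  assumes "q < n" "b + a \<le> k + 1"
  shows "lwalk D (q * K + b) (replicate a 2 @ r) v \<longleftrightarrow> lwalk D (q * K + (b + a)) r v"
  using assms(2)
proof (induction a arbitrary: b)
  case (Suc a)
  have "lwalk D (q * K + b) (replicate (Suc a) 2 @ r) v \<longleftrightarrow>
      lwalk D (q * K + Suc b) (replicate a 2 @ r) v"
    using D_two_gadget[of b q] Suc.prems assms(1) K_gt by auto
  with Suc.IH[of "Suc b"] Suc.prems show ?case by simp
qed simp

text \<open>The ones of a letter are read deterministically inside the gadget; the only choice is
  the arc labelled 3 at offset \<open>a\<close>, and that is the choice of a transition.\<close>

lemma lwalk_nfa:
  assumes "q < n" "y \<in> lists {..<k}"
  shows "lwalk D (q * K) (enc y) v \<longleftrightarrow> (\<exists>q' < n. v = q' * K \<and> lwalk (transitions M) q y q')"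
  using assms
proof (induction y arbitrary: q)
  case Nil
  then show ?case by (auto simp: enc_def)
next
  case (Cons a y)
  have a: "a < k" using Cons.prems by auto
  have "lwalk D (q * K) (enc (a # y)) v \<longleftrightarrow> lwalk D (q * K + 0) (replicate a 2 @ 3 # enc y) v"
    by (simp add: enc_def)
  also have "\<dots> \<longleftrightarrow> lwalk D (q * K + a) (3 # enc y) v"
    using lwalk_ones[of q 0 a "3 # enc y" v] Cons.prems(1) a by simp
  also have "\<dots> \<longleftrightarrow> (\<exists>p. (q, a, p) \<in> transitions M \<and> lwalk D (p * K) (enc y) v)"
    using D_three_nfa[of q a] Cons.prems(1) a K_gt by auto
  also have "\<dots> \<longleftrightarrow> (\<exists>q' < n. v = q' * K \<and> lwalk (transitions M) q (a # y) q')"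
  proof -
    have "lwalk D (p * K) (enc y) v \<longleftrightarrow> (\<exists>q' < n. v = q' * K \<and> lwalk (transitions M) p y q')"
      if "(q, a, p) \<in> transitions M" for p
      using Cons.IH Cons.prems(2) transitions_bound[OF that] by simp
    then show ?thesis unfolding lwalk.simps by blast
  qed
  finally show ?case .
qed

text \<open>A position gadget can be left only at its last vertex, so a walk entering
  \<open>a\<close> steps before it must read exactly \<open>a\<close> ones. The word
  \<open>r\<close> is arbitrary because the part after the centre is not known to be an
  encoding.\<close>

lemma lwalk_string_gadget:
  assumes "i \<le> length x" "a \<le> k + 1" "r \<in> lists {2, 3}"
  shows "lwalk D ((n + i) * K + (k + 1 - a)) r (n * K + (k + 1)) \<longleftrightarrow>
    (\<exists>r'. r = replicate a 2 @ r' \<and> lwalk D ((n + i) * K + (k + 1)) r' (n * K + (k + 1)))"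
  using assms(2,3)
proof (induction a arbitrary: r)
  case (Suc a)
  let ?b = "k + 1 - Suc a"
  have b: "?b < k + 1" "Suc ?b = k + 1 - a" "?b < K" using Suc.prems K_gt by auto
  have ne: "(n + i) * K + ?b \<noteq> n * K + (k + 1)"
    using b K_gt by (subst decode) auto
  show ?case
  proof (cases r)
    case Nil
    then show ?thesis using ne by simp
  next
    case (Cons c r')
    then consider "c = 2" | "c = 3" using Suc.prems by auto
    then show ?thesis
    proof cases
      case 1
      have "lwalk D ((n + i) * K + ?b) r (n * K + (k + 1)) \<longleftrightarrow>
          lwalk D ((n + i) * K + Suc ?b) r' (n * K + (k + 1))"
        using D_two_gadget[OF b(3), of "n + i"] assms(1) b(1) unfolding Cons 1 by auto
      also have "\<dots> \<longleftrightarrow> (\<exists>s. r' = replicate a 2 @ s \<and> lwalk D ((n + i) * K + (k + 1)) s (n * K + (k + 1)))"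
        unfolding b(2) using Suc.prems Cons by (intro Suc.IH) auto
      finally show ?thesis unfolding Cons 1 by simp
    next
      case 2
      have "\<not> lwalk D ((n + i) * K + ?b) r (n * K + (k + 1))"
        using D_three_string[OF assms(1) b(3)] b(1) unfolding Cons 2 by simp
      then show ?thesis unfolding Cons 2 by simp
    qed
  qed
qed simp

text \<open>Without dead arcs the position gadgets form a single path, so one word leads to the
  target. Reversal turns a letter into a 3 followed by its ones, the order in which the next gadget
  is entered and then traversed.\<close>

lemma lwalk_string:
  assumes "i \<le> length x" "r \<in> lists {2, 3}"
  shows "lwalk D ((n + i) * K + (k + 1)) r (n * K + (k + 1)) \<longleftrightarrow> r = rev (enc (take i x))"
  using assms
proof (induction i arbitrary: r)
  case 0
  show ?case
  proof (cases r)
    case (Cons c r')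
    then consider "c = 2" | "c = 3" using 0 by auto
    then show ?thesis
      using D_two_gadget[of "k + 1" n] D_three_string[of 0 "k + 1"] K_gt unfolding Cons
      by cases (simp_all add: enc_def)
  qed (simp add: enc_def)
next
  case (Suc i)
  have ne: "(n + Suc i) * K + (k + 1) \<noteq> n * K + (k + 1)"
    using K_gt by (subst decode) auto
  have enc: "rev (enc (take (Suc i) x)) = 3 # replicate (x ! i) 2 @ rev (enc (take i x))"
    using Suc.prems(1) by (simp add: enc_def take_Suc_conv_app_nth)
  show ?case
  proof (cases r)
    case Nil
    then show ?thesis using ne enc by simp
  next
    case (Cons c r')
    then consider "c = 2" | "c = 3" using Suc.prems by auto
    then show ?thesis
    proof cases
      case 1
      then show ?thesis using D_two_gadget[of "k + 1" "n + Suc i"] K_gt Suc.prems unfolding Cons enc by simp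
    next
      case 2
      have r': "r' \<in> lists {2, 3}" using Suc.prems Cons by auto
      have le: "x ! i \<le> k + 1" using letter_bound[of i] Suc.prems(1) by simp
      have "lwalk D ((n + Suc i) * K + (k + 1)) r (n * K + (k + 1)) \<longleftrightarrow>
          lwalk D ((n + i) * K + (k + 1 - x ! i)) r' (n * K + (k + 1))"
        using D_three_string[OF Suc.prems(1), of "k + 1"] K_gt unfolding Cons 2 by auto
      also have "\<dots> \<longleftrightarrow> (\<exists>s. r' = replicate (x ! i) 2 @ s \<and>
          lwalk D ((n + i) * K + (k + 1)) s (n * K + (k + 1)))"
        using Suc.prems(1) by (intro lwalk_string_gadget le r') simp
      also have "\<dots> \<longleftrightarrow> (\<exists>s. r' = replicate (x ! i) 2 @ s \<and> s = rev (enc (take i x)))"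
      proof (intro ex_cong1 conj_cong refl)
        fix s assume "r' = replicate (x ! i) 2 @ s"
        with r' have "s \<in> lists {2, 3}" by simp
        with Suc.IH Suc.prems(1)
        show "lwalk D ((n + i) * K + (k + 1)) s (n * K + (k + 1)) \<longleftrightarrow> s = rev (enc (take i x))"
          by simp
      qed
      finally show ?thesis unfolding Cons 2 enc by simp
    qed
  qed
qed

text \<open>The half \<open>u\<close> before the centre ranges over all words over 2 and 3. The
  string side alone forces \<open>u = enc x\<close>, so the state side is needed for encodings
  only.\<close>

lemma accepts_iff_palindrome_walk:
  "(\<exists>z \<in> language palindrome_cfg. lwalk D (initial M * K) z (n * K + (k + 1))) \<longleftrightarrow> accepts M x"
proof -
  have "(\<exists>z \<in> language palindrome_cfg. lwalk D (initial M * K) z (n * K + (k + 1))) \<longleftrightarrow>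
     (\<exists>u \<in> lists {2, 3}. \<exists>f \<in> final M. lwalk D (initial M * K) u (f * K) \<and>
        lwalk D (V - 1) (rev u) (n * K + (k + 1)))"
    unfolding language_palindrome_cfg Set.bex_simps(7)
    by (intro bex_cong refl) (auto simp: lwalk_append D_one)
  also have "\<dots> \<longleftrightarrow> (\<exists>u \<in> lists {2, 3}. \<exists>f \<in> final M. lwalk D (initial M * K) u (f * K) \<and> u = enc x)"
  proof (intro bex_cong refl conj_cong)
    fix u :: "nat list" assume "u \<in> lists {2, 3}"
    then have "rev u \<in> lists {2, 3}" by auto
    from lwalk_string[OF order.refl this, unfolded take_all[OF order.refl]]
    show "lwalk D (V - 1) (rev u) (n * K + (k + 1)) \<longleftrightarrow> u = enc x"
      by (simp only: last_vertex rev_is_rev_conv)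
  qed
  also have "\<dots> \<longleftrightarrow> (\<exists>f \<in> final M. lwalk D (initial M * K) (enc x) (f * K))"
    using enc_in_lists by blast
  also have "\<dots> \<longleftrightarrow> accepts M x"
    unfolding accepts_iff_lwalk
    using lwalk_nfa[OF initial_bound, of x] x alphabet K_gt(2) final_bound by auto
  finally show ?thesis .
qed

section \<open>The arcs as a labelled digraph without parallel arcs\<close>

lemma arc_list_bound:
  assumes "(u, a, v) \<in> D" shows "u < V" "v < V" "a < 4"
proof -
  have *: "g * K + b < V" if "g \<le> n + length x" "b < K" for g b
    unfolding V_def using that by (intro gadget_less) auto
  have V: "0 < V" by (simp add: V_def K_def)
  have "u < V \<and> v < V \<and> a < 4"
    using assms unfolding D_iff
  proof (elim disjE exE conjE)
    fix q b q' assume "(q, b, q') \<in> transitions M" "u = q * K + b" "a = 3" "v = q' * K"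
    then show ?thesis using *[of q b] *[of q' 0] transitions_bound[of q b q'] K_gt by simp
  next
    fix q assume "q < n" "u = q * K" "a = of_bool (q \<in> final M)" "v = V - 1"
    then show ?thesis using *[of q 0] K_gt V by simp
  next
    fix i assume "i < length x" "u = (n + Suc i) * K + (k + 1)" "a = 3" "v = (n + i) * K + (k + 1 - x ! i)"
    then show ?thesis using *[of "n + Suc i" "k + 1"] *[of "n + i" "k + 1 - x ! i"] K_gt by simp
  qed auto
  then show "u < V" "v < V" "a < 4" by auto
qed

lemma distinct_arc_list: "distinct (map (\<lambda>(u, a, v). (u, v)) arc_list)"
proof -
  let ?e = "\<lambda>(u :: nat, a :: nat, v :: nat). (u, v)"
  have "inj_on (?e \<circ> tr_arc) (set ds)"
  proof (rule inj_onI)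
    fix d d' assume d: "d \<in> set ds" "d' \<in> set ds" "(?e \<circ> tr_arc) d = (?e \<circ> tr_arc) d'"
    obtain q a p q' a' p' where eq: "d = (q, a, p)" "d' = (q', a', p')" by (cases d, cases d') auto
    have "a < K" "a' < K" using d(1,2) ds(2) eq transitions_bound by (fastforce simp: K_def)+
    then show "d = d'" using d(3) K_gt unfolding eq by (auto simp: tr_arc_def decode)
  qed
  moreover have "inj_on (?e \<circ> fin_arc) {..<n}"
    using K_gt by (auto simp: inj_on_def fin_arc_def)
  moreover have "inj_on (?e \<circ> str_arc) {..<length x}"
    using K_gt by (auto simp: inj_on_def str_arc_def)
  moreover have "inj_on (?e \<circ> chain_arc) {..<V - 1}"
    by (auto simp: inj_on_def chain_arc_def)
  moreover have "(?e \<circ> tr_arc) d \<noteq> (?e \<circ> fin_arc) q" if "d \<in> set ds" for d q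
  proof -
    obtain p a p' where d: "d = (p, a, p')" by (cases d)
    have "p' * K + 0 \<noteq> (n + length x) * K + (k + 1)"
      using K_gt by (subst decode) auto
    then show ?thesis using last_vertex unfolding d by (simp add: tr_arc_def fin_arc_def)
  qed
  moreover have "(?e \<circ> tr_arc) d \<noteq> (?e \<circ> str_arc) i" if "d \<in> set ds" for d i
  proof -
    obtain q a q' where d: "d = (q, a, q')" by (cases d)
    have "q * K + a \<noteq> (n + Suc i) * K + (k + 1)"
      using K_gt transitions_bound[of q a q'] that ds(2) unfolding d by (subst decode) auto
    then show ?thesis unfolding d by (simp add: tr_arc_def str_arc_def)
  qed
  moreover have "(?e \<circ> tr_arc) d \<noteq> (?e \<circ> chain_arc) v" if "d \<in> set ds" for d v
  proof -
    obtain q a q' where d: "d = (q, a, q')" by (cases d)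
    \<comment> \<open>The next vertex on the chain is still inside the gadget, whereas a transition
      arc ends at the start of one.\<close>
    have "q * K + Suc a \<noteq> q' * K + 0"
      using K_gt transitions_bound[of q a q'] that ds(2) unfolding d by (subst decode) auto
    then show ?thesis unfolding d by (auto simp: tr_arc_def chain_arc_def)
  qed
  moreover have "(?e \<circ> fin_arc) q \<noteq> (?e \<circ> str_arc) i" for q i
  proof -
    have "q * K + 0 \<noteq> (n + Suc i) * K + (k + 1)"
      using K_gt by (subst decode) auto
    then show ?thesis by (simp add: fin_arc_def str_arc_def)
  qed
  moreover have "(?e \<circ> fin_arc) q \<noteq> (?e \<circ> chain_arc) v" if "q < n" for q v
  proof -
    \<comment> \<open>A gadget needs two vertices here: with \<open>K = 1\<close> and an empty
      string the last state would precede \<open>V - 1\<close> on the chain. \<open>K\<close> is at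
      least 2 even if \<open>k = 0\<close>.\<close>
    have "q * K + 1 \<noteq> (n + length x) * K + (k + 1)"
      using K_gt that by (subst decode) auto
    then show ?thesis unfolding last_vertex[symmetric] by (auto simp: fin_arc_def chain_arc_def)
  qed
  \<comment> \<open>String arcs lead to smaller vertices, chain arcs to larger ones.\<close>
  moreover have "(?e \<circ> str_arc) i \<noteq> (?e \<circ> chain_arc) v" for i v
    using K_gt by (auto simp: str_arc_def chain_arc_def add_mult_distrib)
  ultimately have "distinct (map (?e \<circ> tr_arc) ds @ map (?e \<circ> fin_arc) [0..<n] @
      map (?e \<circ> str_arc) [0..<length x] @ map (?e \<circ> chain_arc) [0..<V - 1])"
    using ds(1) by - (rule distinct_append4; simp add: distinct_map atLeast0LessThan)
  then show ?thesis by (simp only: arc_list_def map_append map_map)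
qed

definition graph :: "nat pair_pre_digraph" where
  "graph = \<lparr>pverts = {..<V}, parcs = (\<lambda>(u, a, v). (u, v)) ` D\<rparr>"

definition labelling :: "nat \<times> nat \<Rightarrow> nat" where
  "labelling e = the (map_of (map (\<lambda>(u, a, v). ((u, v), a)) arc_list) e)"

lemma labelling_eq: "(u, a, v) \<in> D \<Longrightarrow> labelling (u, v) = a"
proof -
  assume "(u, a, v) \<in> D"
  moreover have "map fst (map (\<lambda>(u, a, v). ((u, v), a)) arc_list) = map (\<lambda>(u, a, v). (u, v)) arc_list"
    by (simp add: case_prod_unfold comp_def)
  ultimately have "map_of (map (\<lambda>(u, a, v). ((u, v), a)) arc_list) (u, v) = Some a"
    using distinct_arc_list by (intro map_of_is_SomeI) (simp only:, force)
  then show ?thesis by (simp add: labelling_def)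
qed

lemma labelled_arcs: "{(u, labelling (u, v), v) | u v. (u, v) \<in> parcs graph} = D"
  using labelling_eq by (force simp: graph_def)

lemma pair_fin_digraph_graph: "pair_fin_digraph graph"
  by unfold_locales (auto simp: graph_def dest: arc_list_bound)

text \<open>Arcs keep the label between the endpoints, as transitions do; the encoding wants it
  last.\<close>

definition cfl_instance :: "nat list" where
  "cfl_instance = [V, length arc_list, initial M * K, n * K + (k + 1)]
     @ concat (map (\<lambda>(u, a, v). [u, v, a]) arc_list)"

lemma vertex_bounds: "initial M * K < V" "n * K + (k + 1) < V"
  using initial_bound gadget_less[of "initial M" "n + length x + 1" 0]
    gadget_less[of n "n + length x + 1" "k + 1"] K_gt
  by (simp_all add: V_def del: mult_Suc)

lemma cfl_instance_in_cfl_reachability: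
  "(cfl_instance, accepts M x) \<in> cfl_reachability palindrome_cfg V"
proof -
  let ?s = "initial M * K" and ?t = "n * K + (k + 1)"
  interpret pair_fin_digraph graph by (rule pair_fin_digraph_graph)
  have "accepts M x = cfl_reachable palindrome_cfg graph labelling ?s ?t"
    unfolding accepts_iff_palindrome_walk[symmetric] labelled_arcs[symmetric]
    using vertex_bounds
    by (intro cfl_reachable_iff_lwalk[symmetric] pair_wf_digraph_axioms) (simp add: graph_def)
  moreover have "cfl_encoding graph labelling ?s ?t cfl_instance"
    unfolding cfl_encoding_def
  proof (intro exI conjI)
    show "distinct (map (\<lambda>(u, a, v). (u, v)) arc_list)" by (rule distinct_arc_list)
    show "set (map (\<lambda>(u, a, v). (u, v)) arc_list) = parcs graph" by (simp add: graph_def)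
    have "map (\<lambda>(u, a, v). [u, v, a]) arc_list =
        map ((\<lambda>(u, v). [u, v, labelling (u, v)]) \<circ> (\<lambda>(u, a, v). (u, v))) arc_list"
      using labelling_eq by (intro map_cong) auto
    then have "concat (map (\<lambda>(u, a, v). [u, v, a]) arc_list) =
        concat (map (\<lambda>(u, v). [u, v, labelling (u, v)]) (map (\<lambda>(u, a, v). (u, v)) arc_list))"
      by (simp only: map_map)
    then show "cfl_instance = [card (pverts graph), length (map (\<lambda>(u, a, v). (u, v)) arc_list), ?s, ?t] @
        concat (map (\<lambda>(u, v). [u, v, labelling (u, v)]) (map (\<lambda>(u, a, v). (u, v)) arc_list))"
      by (simp only: cfl_instance_def) (simp add: graph_def)
  qed
  moreover have "labelling ` parcs graph \<subseteq> terminals palindrome_cfg"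
    using labelling_eq arc_list_bound(3) by (fastforce simp: graph_def)
  moreover have "?s \<in> pverts graph" "?t \<in> pverts graph" "pverts graph = {..<V}"
    using vertex_bounds by (auto simp: graph_def)
  ultimately show ?thesis
    unfolding cfl_reachability_def using pair_fin_digraph_graph by blast
qed

end


section \<open>Running word RAM programs\<close>

text \<open>A larger capacity only removes obstacles. This lets the given algorithm run under the
  capacity of the NFA word.\<close>

lemma exec_mono: "exec B p s t s' \<Longrightarrow> B \<le> B' \<Longrightarrow> exec B' p s t s'"
  by (induction rule: exec.induct) (rule exec.intros; simp; fail)+

text \<open>Total correctness with a time bound, for programs that do not flip coins.\<close>

definition run :: "nat \<Rightarrow> bool stream \<Rightarrow> prog \<Rightarrow> (nat \<Rightarrow> nat) \<Rightarrow> (nat \<Rightarrow> nat) \<Rightarrow> nat \<Rightarrow>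
    ((nat \<Rightarrow> nat) \<Rightarrow> (nat \<Rightarrow> nat) \<Rightarrow> bool) \<Rightarrow> bool" where
  "run B \<omega> p R H t Q \<longleftrightarrow>
     (\<exists>t' R' H'. exec B p \<lparr>regs = R, mem = H, coins = \<omega>\<rparr> t' \<lparr>regs = R', mem = H', coins = \<omega>\<rparr> \<and>
        t' \<le> t \<and> Q R' H')"

lemma run_Seq:
  assumes "run B \<omega> p R H t P" "\<And>R H. P R H \<Longrightarrow> run B \<omega> q R H u Q"
  shows "run B \<omega> (Seq p q) R H (t + u) Q"
  using assms unfolding run_def by (blast intro: exec.Seq add_mono)

lemma run_mono:
  assumes "run B \<omega> p R H t P" "t \<le> u" "\<And>R H. P R H \<Longrightarrow> Q R H"
  shows "run B \<omega> p R H u Q"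
  using assms unfolding run_def by (meson order_trans)

text \<open>The invariant is indexed by the iterations left, so one induction yields termination and
  time. Every test of the loop register costs one step.\<close>

lemma run_WhileNZ:
  assumes step: "\<And>j R H. I (Suc j) R H \<Longrightarrow> R r \<noteq> 0 \<and> run B \<omega> p R H t (I j)"
    and stop: "\<And>R H. I 0 R H \<Longrightarrow> R r = 0"
    and I: "I j R H"
  shows "run B \<omega> (WhileNZ r p) R H (j * (t + 1) + 1) (I 0)"
  using I
proof (induction j arbitrary: R H)
  case 0
  then show ?case
    unfolding run_def using exec.WhileFalse[of "\<lparr>regs = R, mem = H, coins = \<omega>\<rparr>" r B p] stop by auto
next
  case (Suc j)
  from step[OF Suc.prems] obtain t1 R1 H1 where 1: "R r \<noteq> 0" "t1 \<le> t" "I j R1 H1"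
    "exec B p \<lparr>regs = R, mem = H, coins = \<omega>\<rparr> t1 \<lparr>regs = R1, mem = H1, coins = \<omega>\<rparr>"
    unfolding run_def by blast
  from Suc.IH[OF 1(3)] obtain t2 R2 H2 where 2: "t2 \<le> j * (t + 1) + 1" "I 0 R2 H2"
    "exec B (WhileNZ r p) \<lparr>regs = R1, mem = H1, coins = \<omega>\<rparr> t2 \<lparr>regs = R2, mem = H2, coins = \<omega>\<rparr>"
    unfolding run_def by blast
  have "exec B (WhileNZ r p) \<lparr>regs = R, mem = H, coins = \<omega>\<rparr> (t1 + t2 + 1)
      \<lparr>regs = R2, mem = H2, coins = \<omega>\<rparr>"
    using 1 2 by (intro exec.WhileTrue) auto
  then show ?case
    unfolding run_def using 1(2) 2(1,2) by (intro exI conjI) auto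
qed

text \<open>Weakest preconditions of straight-line code. For flips, branches and loops the value is
  \<open>False\<close>, which makes \<open>run_wp\<close> vacuous there and the default cost
  harmless.\<close>

fun wp :: "nat \<Rightarrow> prog \<Rightarrow> ((nat \<Rightarrow> nat) \<Rightarrow> (nat \<Rightarrow> nat) \<Rightarrow> bool) \<Rightarrow> (nat \<Rightarrow> nat) \<Rightarrow> (nat \<Rightarrow> nat) \<Rightarrow> bool"
where
  "wp B (Const r v) Q R H \<longleftrightarrow> v < B \<and> Q (R(r := v)) H"
| "wp B (Binop f r a b) Q R H \<longleftrightarrow>
     binop_sem f (R a) (R b) < B \<and> Q (R(r := binop_sem f (R a) (R b))) H"
| "wp B (Load r a) Q R H \<longleftrightarrow> Q (R(r := H (R a))) H"
| "wp B (Store a r) Q R H \<longleftrightarrow> Q R (H(R a := R r))"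
| "wp B (Seq p q) Q R H \<longleftrightarrow> wp B p (wp B q Q) R H"
| "wp B _ Q R H \<longleftrightarrow> False"

fun cost :: "prog \<Rightarrow> nat" where
  "cost (Seq p q) = cost p + cost q"
| "cost _ = 1"

lemma run_wp: "wp B p Q R H \<Longrightarrow> run B \<omega> p R H (cost p) Q"
proof (induction p arbitrary: Q R H)
  case (Const r v)
  then show ?case using exec.Const[of v B r "\<lparr>regs = R, mem = H, coins = \<omega>\<rparr>"] by (auto simp: run_def)
next
  case (Binop f r a b)
  then show ?case using exec.Binop[of f "\<lparr>regs = R, mem = H, coins = \<omega>\<rparr>" a b B r] by (auto simp: run_def)
next
  case (Load r a)
  then show ?case using exec.Load[of B r a "\<lparr>regs = R, mem = H, coins = \<omega>\<rparr>"] by (auto simp: run_def)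
next
  case (Store a r)
  then show ?case using exec.Store[of B a r "\<lparr>regs = R, mem = H, coins = \<omega>\<rparr>"] by (auto simp: run_def)
next
  case (Seq p q)
  then show ?case using run_Seq[of B \<omega> p R H "cost p" "wp B q Q" q "cost q" Q] by simp
qed auto

text \<open>There is no empty program, so the first instruction is a separate argument.\<close>

primrec block :: "prog \<Rightarrow> prog list \<Rightarrow> prog" where
  "block p [] = p"
| "block p (q # qs) = Seq p (block q qs)"

definition clear :: "nat \<Rightarrow> prog" where
  "clear r = block (Const 0 0) (map (\<lambda>i. Const i 0) [1..<r])"

lemma wp_clear:
  assumes "0 < B"
  shows "wp B (block (Const a 0) (map (\<lambda>i. Const i 0) rs)) Q R H \<longleftrightarrow>
    Q (\<lambda>i. if i \<in> set (a # rs) then 0 else R i) H"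
proof (induction rs arbitrary: a R)
  case Nil
  have "R(a := 0) = (\<lambda>i. if i \<in> set [a] then 0 else R i)" by auto
  then show ?case using assms by (simp only: list.map block.simps wp.simps simp_thms)
next
  case (Cons b rs)
  have "(\<lambda>i. if i \<in> set (b # rs) then 0 else (R(a := 0)) i) =
      (\<lambda>i. if i \<in> set (a # b # rs) then 0 else R i)"
    by auto
  with Cons assms show ?case by (simp only: list.map block.simps wp.simps simp_thms)
qed

section \<open>Memory contents as lists\<close>

definition reads :: "(nat \<Rightarrow> 'a) \<Rightarrow> nat \<Rightarrow> 'a list \<Rightarrow> bool" where
  "reads H a ys \<longleftrightarrow> (\<forall>i < length ys. H (a + i) = ys ! i)"

lemma reads_Nil [simp]: "reads H a []"
  by (simp add: reads_def)

lemma reads_Cons [simp]: "reads H a (y # ys) \<longleftrightarrow> H a = y \<and> reads H (Suc a) ys"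
  by (simp add: reads_def All_less_Suc2)

lemma reads_append: "reads H a (ys @ zs) \<longleftrightarrow> reads H a ys \<and> reads H (a + length ys) zs"
  by (induction ys arbitrary: a) auto

lemma reads_map_upt: "reads H a (map f [0..<n]) \<longleftrightarrow> (\<forall>i < n. H (a + i) = f i)"
  by (simp add: reads_def)

lemma length_concat_const: "(\<And>d. length (f d) = c) \<Longrightarrow> length (concat (map f ds)) = c * length ds"
  by (induction ds) auto

lemma reads_concat:
  assumes "\<And>d. length (f d) = c"
  shows "reads H a (concat (map f ds)) \<longleftrightarrow> (\<forall>i < length ds. reads H (a + c * i) (f (ds ! i)))"
proof (induction ds arbitrary: a)
  case (Cons d ds)
  then show ?case
    by (simp add: reads_append All_less_Suc2 assms add.assoc)
qed simp

definition memory :: "nat list \<Rightarrow> nat \<Rightarrow> nat" where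
  "memory w = (\<lambda>i. if i < length w then w ! i else 0)"

lemma reads_memory: "reads (memory w) 0 w"
  by (simp add: reads_def memory_def)

lemma initial_machine_eq: "initial_machine w \<omega> = \<lparr>regs = \<lambda>_. 0, mem = memory w, coins = \<omega>\<rparr>"
  by (simp add: initial_machine_def memory_def)

lemma eq_memory:
  assumes "reads H 0 w" "\<forall>a \<ge> length w. H a = 0"
  shows "H = memory w"
  using assms by (auto simp: reads_def memory_def)

section \<open>The reduction as a program\<close>

text \<open>
  The graph overwrites the input in place. The arc triples of the transitions start one word before
  the input triples, so transitions are processed upwards; the accepting bits and letters grow from
  one word to three, so they are processed downwards; the chain arcs come last. Registers: 0, 1, 6
  hold the constants 0, 1, 3; 2, 3, 5, 7, 9 the input parameters \<open>n\<close>, \<open>k\<close>, \<open>initial M\<close>,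
  \<open>m\<close>, \<open>l\<close>; 10, 11, 13 hold \<open>K\<close>, \<open>n + l\<close>, \<open>V - 1\<close>; 18 is the loop counter; 17, 25, 26
  are memory pointers.
\<close>

definition setup_prog :: prog where
  "setup_prog = block (Const 1 1)
     [Load 2 0, Load 3 1, Const 4 2, Load 5 4, Const 6 3, Load 7 6, Const 8 4, Load 9 8,
      Binop Add 10 3 4, Binop Add 11 2 9,
      Binop Add 12 11 1, Binop Mul 12 12 10, Binop Sub 13 12 1,
      Binop Add 14 13 7, Binop Add 14 14 11,
      Binop Mul 15 5 10,
      Binop Mul 16 2 10, Binop Add 16 16 10, Binop Sub 16 16 1,
      Store 0 12, Store 1 14, Store 4 15, Store 6 16,
      Binop Add 17 8 0, Binop Add 18 7 0]"

text \<open>The header shrinks from five words to four, whence the shift by one. The old and the new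
  triple share two words, so all three words are loaded before the first store.\<close>

definition tr_body :: prog where
  "tr_body = block (Binop Add 19 17 1)
     [Load 20 19, Binop Add 21 19 1, Load 22 21, Binop Add 23 21 1, Load 24 23,
      Binop Mul 20 20 10, Binop Add 20 20 22, Binop Mul 24 24 10,
      Store 17 20, Store 19 24, Store 21 6,
      Binop Add 17 17 6, Binop Sub 18 18 1]"

definition str_setup :: prog where
  "str_setup = block (Binop Add 25 17 1)
     [Binop Add 25 25 11, Binop Mul 26 11 6, Binop Add 26 26 17, Binop Add 27 13 0, Binop Add 18 9 0]"

definition str_body :: prog where
  "str_body = block (Binop Sub 25 25 1)
     [Binop Sub 26 26 6, Binop Sub 18 18 1, Load 20 25,
      Binop Sub 24 27 10, Binop Sub 28 24 20,
      Binop Add 19 26 1, Binop Add 21 19 1,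
      Store 26 27, Store 19 28, Store 21 6, Binop Add 27 24 0]"

definition fin_setup :: prog where
  "fin_setup = block (Binop Mul 27 2 10) [Binop Add 18 2 0]"

text \<open>The accepting bit already is the label: 1 for the centre, 0 for a dead arc.\<close>

definition fin_body :: prog where
  "fin_body = block (Binop Sub 25 25 1)
     [Binop Sub 26 26 6, Binop Sub 18 18 1, Binop Sub 27 27 10, Load 20 25,
      Binop Add 19 26 1, Binop Add 21 19 1,
      Store 26 27, Store 19 13, Store 21 20]"

definition chain_setup :: prog where
  "chain_setup = block (Binop Mul 26 11 6)
     [Binop Add 26 26 17, Binop Add 18 13 0, Binop Add 27 0 0]"

text \<open>The label is computed without a branch, by doubling the truth value of
  \<open>0 < Suc v mod K\<close>, so that \<open>wp\<close> applies.\<close>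

definition chain_body :: prog where
  "chain_body = block (Binop Add 28 27 1)
     [Binop Mod 20 28 10, Binop Lt 20 0 20, Binop Add 20 20 20,
      Binop Add 19 26 1, Binop Add 21 19 1,
      Store 26 27, Store 19 28, Store 21 20,
      Binop Add 26 26 6, Binop Add 27 28 0, Binop Sub 18 18 1]"

definition reduction_prog :: prog where
  "reduction_prog = block setup_prog
     [WhileNZ 18 tr_body, str_setup, WhileNZ 18 str_body, fin_setup, WhileNZ 18 fin_body,
      chain_setup, WhileNZ 18 chain_body, clear 29]"

definition stores_arc :: "(nat \<Rightarrow> nat) \<Rightarrow> nat \<Rightarrow> nat \<times> nat \<times> nat \<Rightarrow> bool" where
  "stores_arc H a e \<longleftrightarrow> H a = fst e \<and> H (a + 1) = snd (snd e) \<and> H (a + 2) = fst (snd e)"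

lemma stores_arc_iff_reads: "stores_arc H a e \<longleftrightarrow> reads H a (case e of (u, b, v) \<Rightarrow> [u, v, b])"
  by (cases e) (simp add: stores_arc_def)

section \<open>Memory layout and loop invariants\<close>

context nfa_instance
begin

abbreviation "m \<equiv> length ds"
abbreviation "l \<equiv> length x"
definition E :: nat where "E = V - 1 + m + n + l"

lemma length_arc_list: "length arc_list = E"
  by (simp add: arc_list_def E_def)

definition nfa_word :: "nat list" where
  "nfa_word = [n, k, initial M, m, l] @ concat (map (\<lambda>(q, a, q'). [q, a, q']) ds)
     @ map (\<lambda>q. of_bool (q \<in> final M)) [0..<n] @ x"

text \<open>The programs use registers below 29 only; together with \<open>clear 29\<close> the last
  clause makes all registers zero at the end.\<close>

definition env :: "(nat \<Rightarrow> nat) \<Rightarrow> bool" where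
  "env R \<longleftrightarrow> R 0 = 0 \<and> R 1 = 1 \<and> R 2 = n \<and> R 6 = 3 \<and> R 7 = m \<and> R 9 = l \<and> R 10 = K \<and>
     R 11 = n + l \<and> R 13 = V - 1 \<and> (\<forall>r \<ge> 29. R r = 0)"

definition header :: "(nat \<Rightarrow> nat) \<Rightarrow> bool" where
  "header H \<longleftrightarrow> H 0 = V \<and> H 1 = E \<and> H 2 = initial M * K \<and> H 3 = n * K + (k + 1)"

definition tr_inv :: "nat \<Rightarrow> (nat \<Rightarrow> nat) \<Rightarrow> (nat \<Rightarrow> nat) \<Rightarrow> bool" where
  "tr_inv j R H \<longleftrightarrow> env R \<and> header H \<and>
     (\<exists>i. i + j = m \<and> R 18 = j \<and> R 17 = 4 + 3 * i \<and>
       (\<forall>d < i. stores_arc H (4 + 3 * d) (tr_arc (ds ! d))) \<and>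
       (\<forall>d < m. i \<le> d \<longrightarrow> reads H (5 + 3 * d) (case ds ! d of (q, a, q') \<Rightarrow> [q, a, q']))) \<and>
     (\<forall>q < n. H (5 + 3 * m + q) = of_bool (q \<in> final M)) \<and>
     (\<forall>i < l. H (5 + 3 * m + n + i) = x ! i) \<and>
     (\<forall>a \<ge> 5 + 3 * m + n + l. H a = 0)"

text \<open>Moving downwards is safe: the arc of letter \<open>i\<close> starts at
  \<open>4 + 3 * m + 3 * (n + i)\<close>, and what is still unread by then lies below
  \<open>5 + 3 * m + n + i\<close>, which is no larger since \<open>n\<close> is positive.\<close>

definition str_inv :: "nat \<Rightarrow> (nat \<Rightarrow> nat) \<Rightarrow> (nat \<Rightarrow> nat) \<Rightarrow> bool" where
  "str_inv j R H \<longleftrightarrow> env R \<and> header H \<and> j \<le> l \<and>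
     R 18 = j \<and> R 17 = 4 + 3 * m \<and> R 25 = 5 + 3 * m + n + j \<and> R 26 = 4 + 3 * m + 3 * (n + j) \<and>
     R 27 = (n + j) * K + (k + 1) \<and>
     (\<forall>d < m. stores_arc H (4 + 3 * d) (tr_arc (ds ! d))) \<and>
     (\<forall>q < n. H (5 + 3 * m + q) = of_bool (q \<in> final M)) \<and>
     (\<forall>i < j. H (5 + 3 * m + n + i) = x ! i) \<and>
     (\<forall>i < l. j \<le> i \<longrightarrow> stores_arc H (4 + 3 * m + 3 * (n + i)) (str_arc i)) \<and>
     (\<forall>a \<ge> 4 + 3 * m + 3 * (n + l). H a = 0)"

definition fin_inv :: "nat \<Rightarrow> (nat \<Rightarrow> nat) \<Rightarrow> (nat \<Rightarrow> nat) \<Rightarrow> bool" where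
  "fin_inv j R H \<longleftrightarrow> env R \<and> header H \<and> j \<le> n \<and>
     R 18 = j \<and> R 17 = 4 + 3 * m \<and> R 25 = 5 + 3 * m + j \<and> R 26 = 4 + 3 * m + 3 * j \<and>
     R 27 = j * K \<and>
     (\<forall>d < m. stores_arc H (4 + 3 * d) (tr_arc (ds ! d))) \<and>
     (\<forall>q < j. H (5 + 3 * m + q) = of_bool (q \<in> final M)) \<and>
     (\<forall>q < n. j \<le> q \<longrightarrow> stores_arc H (4 + 3 * m + 3 * q) (fin_arc q)) \<and>
     (\<forall>i < l. stores_arc H (4 + 3 * m + 3 * (n + i)) (str_arc i)) \<and>
     (\<forall>a \<ge> 4 + 3 * m + 3 * (n + l). H a = 0)"

definition chain_inv :: "nat \<Rightarrow> (nat \<Rightarrow> nat) \<Rightarrow> (nat \<Rightarrow> nat) \<Rightarrow> bool" where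
  "chain_inv j R H \<longleftrightarrow> env R \<and> header H \<and>
     (\<exists>i. i + j = V - 1 \<and> R 18 = j \<and> R 26 = 4 + 3 * m + 3 * (n + l) + 3 * i \<and> R 27 = i \<and>
       (\<forall>v < i. stores_arc H (4 + 3 * m + 3 * (n + l) + 3 * v) (chain_arc v)) \<and>
       (\<forall>a \<ge> 4 + 3 * m + 3 * (n + l) + 3 * i. H a = 0)) \<and>
     (\<forall>d < m. stores_arc H (4 + 3 * d) (tr_arc (ds ! d))) \<and>
     (\<forall>q < n. stores_arc H (4 + 3 * m + 3 * q) (fin_arc q)) \<and>
     (\<forall>i < l. stores_arc H (4 + 3 * m + 3 * (n + i)) (str_arc i))"

lemma size_bounds:
  "K \<le> V" "n + l < V" "n * K + K \<le> V" "m \<le> E" "n + l + m \<le> E" "V - 1 + (n + l) + m = E" "0 < V"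
proof -
  have V: "V = n * K + l * K + K" by (simp add: V_def algebra_simps)
  then show "K \<le> V" "n * K + K \<le> V" "0 < V" using K_gt by auto
  have "n * 1 \<le> n * K" "l * 1 \<le> l * K" using K_gt by (intro mult_left_mono; simp)+
  then show "n + l < V" unfolding V using K_gt by linarith
qed (auto simp: E_def)

lemma length_nfa_word: "length nfa_word = 5 + 3 * m + n + l"
proof -
  have "length (concat (map (\<lambda>(q, a, q'). [q, a, q']) ds)) = 3 * m"
    by (intro length_concat_const) auto
  then show ?thesis by (simp add: nfa_word_def)
qed

lemma memory_nfa_word:
  "memory nfa_word 0 = n" "memory nfa_word 1 = k" "memory nfa_word 2 = initial M"
  "memory nfa_word 3 = m" "memory nfa_word 4 = l"
  "\<forall>d < m. reads (memory nfa_word) (5 + 3 * d) (case ds ! d of (q, a, q') \<Rightarrow> [q, a, q'])"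
  "\<forall>q < n. memory nfa_word (5 + 3 * m + q) = of_bool (q \<in> final M)"
  "\<forall>i < l. memory nfa_word (5 + 3 * m + n + i) = x ! i"
  "\<forall>a \<ge> 5 + 3 * m + n + l. memory nfa_word a = 0"
proof -
  have 3: "length (case d of (q, a, q') \<Rightarrow> [q, a, q']) = 3" for d :: "nat \<times> nat \<times> nat"
    by (simp split: prod.split)
  have "reads (memory nfa_word) 0 nfa_word" by (rule reads_memory)
  then have *: "reads (memory nfa_word) 0 [n, k, initial M, m, l]"
    "\<forall>d < m. reads (memory nfa_word) (5 + 3 * d) (case ds ! d of (q, a, q') \<Rightarrow> [q, a, q'])"
    "\<forall>q < n. memory nfa_word (5 + 3 * m + q) = of_bool (q \<in> final M)"
    "reads (memory nfa_word) (5 + 3 * m + n) x"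
    \<comment> \<open>Only the list being read is unfolded; the occurrence inside
      \<open>memory\<close> stays folded.\<close>
    unfolding nfa_word_def[THEN arg_cong[of _ _ "reads (memory nfa_word) 0"]]
      reads_append reads_map_upt length_concat_const[of "\<lambda>(q, a, q'). [q, a, q']" 3 ds, OF 3]
      reads_concat[of "\<lambda>(q, a, q'). [q, a, q']" 3, OF 3]
    by (simp_all add: numeral_eq_Suc)
  show "\<forall>a \<ge> 5 + 3 * m + n + l. memory nfa_word a = 0"
    unfolding memory_def length_nfa_word by simp
  show "memory nfa_word 0 = n" "memory nfa_word 1 = k" "memory nfa_word 2 = initial M"
    "memory nfa_word 3 = m" "memory nfa_word 4 = l"
    using *(1) by (simp_all add: numeral_eq_Suc)
  show "\<forall>d < m. reads (memory nfa_word) (5 + 3 * d) (case ds ! d of (q, a, q') \<Rightarrow> [q, a, q'])"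
    "\<forall>q < n. memory nfa_word (5 + 3 * m + q) = of_bool (q \<in> final M)"
    by (fact *(2), fact *(3))
  show "\<forall>i < l. memory nfa_word (5 + 3 * m + n + i) = x ! i"
    using *(4) by (simp add: reads_def)
qed

section \<open>Correctness and cost of the program\<close>

context
  fixes B :: nat
  \<comment> \<open>\<open>3 * E\<close> covers the addresses of the arcs, \<open>V\<close> the
    vertices, and 10 the header and small constants.\<close>
  assumes B: "V + 3 * E + 10 < B"
begin

lemma run_tr_body:
  assumes "tr_inv (Suc j) R H"
  shows "run B \<omega> tr_body R H (cost tr_body) (tr_inv j)"
proof (rule run_wp)
  from assms obtain i where i: "i + Suc j = m" "R 18 = Suc j" "R 17 = 4 + 3 * i"
    "\<forall>d < i. stores_arc H (4 + 3 * d) (tr_arc (ds ! d))"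
    "\<forall>d < m. i \<le> d \<longrightarrow> reads H (5 + 3 * d) (case ds ! d of (q, a, q') \<Rightarrow> [q, a, q'])"
    and inv: "env R" "header H" "\<forall>q < n. H (5 + 3 * m + q) = of_bool (q \<in> final M)"
      "\<forall>i < l. H (5 + 3 * m + n + i) = x ! i" "\<forall>a \<ge> 5 + 3 * m + n + l. H a = 0"
    unfolding tr_inv_def by blast
  obtain q a q' where d: "ds ! i = (q, a, q')" by (cases "ds ! i")
  have im: "i < m" using i(1) by simp
  then have tr: "(q, a, q') \<in> transitions M" using d ds(2) nth_mem by fastforce
  have rd: "H (5 + 3 * i) = q" "H (6 + 3 * i) = a" "H (7 + 3 * i) = q'"
    using i(5) im d by auto
  have "(q * K + a, 3, q' * K) \<in> D" using tr D_iff by blast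
  then have bd: "q * K + a < V" "q' * K < V" by (auto dest: arc_list_bound)
  define H' where "H' = H(4 + 3 * i := q * K + a, 5 + 3 * i := q' * K, 6 + 3 * i := 3)"
  have H'1: "stores_arc H' (4 + 3 * i) (tr_arc (ds ! i))"
    by (simp add: stores_arc_def H'_def d tr_arc_def)
  have H'2: "H' b = H b" if "b < 4 + 3 * i \<or> 7 + 3 * i \<le> b" for b
    using that by (auto simp: H'_def)
  \<comment> \<open>Stated for arbitrary registers, so that symbolic execution has to supply only
    the values that changed and \<open>env\<close>. The other bodies follow the same
    pattern.\<close>
  have post: "tr_inv j R' H'" if "env R'" "R' 18 = j" "R' 17 = 7 + 3 * i" for R'
    unfolding tr_inv_def
  proof (intro conjI exI[of _ "Suc i"])
    show "header H'" using inv(2) unfolding header_def by (simp add: H'2)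
    show "\<forall>d<Suc i. stores_arc H' (4 + 3 * d) (tr_arc (ds ! d))"
      using i(4) H'1 by (simp add: less_Suc_eq stores_arc_def H'2)
    show "\<forall>d<m. Suc i \<le> d \<longrightarrow> reads H' (5 + 3 * d) (case ds ! d of (q, a, q') \<Rightarrow> [q, a, q'])"
      using i(5) by (auto simp: H'2 split: prod.splits)
  qed (use inv(3-5) i(1) im that in \<open>auto simp: H'2\<close>)
  have "7 + 3 * i < B" "j < B" using i(1) im size_bounds B by linarith+
  then show "wp B tr_body (tr_inv j) R H"
    using inv(1) bd rd B i(2,3) post unfolding H'_def
    by (simp add: env_def tr_body_def add.assoc)
qed

lemma run_str_body:
  assumes "str_inv (Suc j) R H"
  shows "run B \<omega> str_body R H (cost str_body) (str_inv j)"
proof (rule run_wp)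
  let ?a = "4 + 3 * m + 3 * (n + j)"
  note inv = assms[unfolded str_inv_def]
  have j: "j < l" using inv by simp
  have rg: "env R" "R 18 = Suc j" "R 17 = 4 + 3 * m" "R 25 = 5 + 3 * m + n + Suc j"
    "R 26 = 4 + 3 * m + 3 * (n + Suc j)" "R 27 = (n + Suc j) * K + (k + 1)"
    using inv by auto
  have x: "H (5 + 3 * m + n + j) = x ! j" "x ! j < k" using inv letter_bound[OF j] by auto
  define H' where "H' = H(?a := (n + Suc j) * K + (k + 1), ?a + 1 := (n + j) * K + (k + 1 - x ! j), ?a + 2 := 3)"
  have H'1: "stores_arc H' ?a (str_arc j)"
    by (simp add: stores_arc_def H'_def str_arc_def)
  have H'2: "H' b = H b" if "b < ?a \<or> ?a + 3 \<le> b" for b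
    using that by (auto simp: H'_def)
  have post: "str_inv j R' H'" if "env R'" "R' 18 = j" "R' 17 = 4 + 3 * m" "R' 25 = 5 + 3 * m + n + j"
      "R' 26 = ?a" "R' 27 = (n + j) * K + (k + 1)" for R'
    unfolding str_inv_def
  proof (intro conjI)
    show "header H'" using inv unfolding header_def by (simp add: H'2)
    show "\<forall>d<m. stores_arc H' (4 + 3 * d) (tr_arc (ds ! d))"
      using inv by (simp add: stores_arc_def H'2)
    show "\<forall>i<l. j \<le> i \<longrightarrow> stores_arc H' (4 + 3 * m + 3 * (n + i)) (str_arc i)"
    proof (intro allI impI)
      fix i assume i: "i < l" "j \<le> i"
      show "stores_arc H' (4 + 3 * m + 3 * (n + i)) (str_arc i)"
      proof (cases "i = j")
        case False
        then show ?thesis using inv i unfolding stores_arc_def by (subst (1 2 3) H'2) auto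
      qed (use H'1 in simp)
    qed
  qed (use inv j that in \<open>auto simp: H'2\<close>)
  have e: "(n + Suc j) * K + (k + 1) - K = (n + j) * K + (k + 1)" by simp
  have "(n + j) * K + (k + 1) < V" "(n + Suc j) * K + (k + 1) < V"
    unfolding V_def using K_gt j by (intro gadget_less; simp)+
  then have "?a + 3 < B" "(n + j) * K + (k + 1) < B" "(n + Suc j) * K + (k + 1) < B"
    using j size_bounds B unfolding distrib_left by linarith+
  then show "wp B str_body (str_inv j) R H"
    using rg x B post e unfolding H'_def
    by (simp add: env_def str_body_def add.assoc)
qed

lemma run_fin_body:
  assumes "fin_inv (Suc j) R H"
  shows "run B \<omega> fin_body R H (cost fin_body) (fin_inv j)"
proof (rule run_wp)
  let ?a = "4 + 3 * m + 3 * j"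
  note inv = assms[unfolded fin_inv_def]
  have j: "j < n" using inv by simp
  have b: "H (5 + 3 * m + j) = of_bool (j \<in> final M)" using inv by auto
  have rg: "env R" "R 18 = Suc j" "R 17 = 4 + 3 * m" "R 25 = 5 + 3 * m + Suc j"
    "R 26 = 4 + 3 * m + 3 * Suc j" "R 27 = Suc j * K"
    using inv by auto
  define H' where "H' = H(?a := j * K, ?a + 1 := V - 1, ?a + 2 := of_bool (j \<in> final M))"
  have H'1: "stores_arc H' ?a (fin_arc j)"
    by (simp add: stores_arc_def H'_def fin_arc_def)
  have H'2: "H' b = H b" if "b < ?a \<or> ?a + 3 \<le> b" for b
    using that by (auto simp: H'_def)
  have post: "fin_inv j R' H'" if "env R'" "R' 18 = j" "R' 17 = 4 + 3 * m" "R' 25 = 5 + 3 * m + j"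
      "R' 26 = ?a" "R' 27 = j * K" for R'
    unfolding fin_inv_def
  proof (intro conjI)
    show "header H'" using inv unfolding header_def by (simp add: H'2)
    show "\<forall>d<m. stores_arc H' (4 + 3 * d) (tr_arc (ds ! d))"
      using inv by (simp add: stores_arc_def H'2)
    show "\<forall>q<n. j \<le> q \<longrightarrow> stores_arc H' (4 + 3 * m + 3 * q) (fin_arc q)"
    proof (intro allI impI)
      fix q assume q: "q < n" "j \<le> q"
      show "stores_arc H' (4 + 3 * m + 3 * q) (fin_arc q)"
      proof (cases "q = j")
        case False
        then show ?thesis using inv q unfolding stores_arc_def by (subst (1 2 3) H'2) auto
      qed (use H'1 in simp)
    qed
    show "\<forall>i<l. stores_arc H' (4 + 3 * m + 3 * (n + i)) (str_arc i)"
      using inv j by (simp add: stores_arc_def H'2)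
  qed (use inv j that in \<open>auto simp: H'2\<close>)
  have e: "Suc j * K - K = j * K" by simp
  have "j * K + 0 < V" "Suc j * K + 0 < V"
    unfolding V_def using K_gt j by (intro gadget_less; simp)+
  then have "?a + 3 < B" "j * K < B" "Suc j * K < B"
    using j size_bounds B by linarith+
  then show "wp B fin_body (fin_inv j) R H"
    using rg b B post e unfolding H'_def
    by (simp add: env_def fin_body_def add.assoc)
qed

lemma run_chain_body:
  assumes "chain_inv (Suc j) R H"
  shows "run B \<omega> chain_body R H (cost chain_body) (chain_inv j)"
proof (rule run_wp)
  let ?c = "4 + 3 * m + 3 * (n + l)"
  from assms obtain i where i: "i + Suc j = V - 1" "R 18 = Suc j" "R 26 = ?c + 3 * i" "R 27 = i"
    "\<forall>v < i. stores_arc H (?c + 3 * v) (chain_arc v)" "\<forall>a \<ge> ?c + 3 * i. H a = 0"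
    and inv: "env R" "header H" "\<forall>d < m. stores_arc H (4 + 3 * d) (tr_arc (ds ! d))"
     "\<forall>q < n. stores_arc H (4 + 3 * m + 3 * q) (fin_arc q)"
     "\<forall>i < l. stores_arc H (4 + 3 * m + 3 * (n + i)) (str_arc i)"
    unfolding chain_inv_def by blast
  let ?a = "?c + 3 * i"
  define H' where "H' = H(?a := i, ?a + 1 := Suc i, ?a + 2 := of_bool (0 < Suc i mod K) + of_bool (0 < Suc i mod K))"
  have H'1: "stores_arc H' ?a (chain_arc i)"
    by (simp add: stores_arc_def H'_def chain_arc_def)
  have H'2: "H' b = H b" if "b < ?a \<or> ?a + 3 \<le> b" for b
    using that by (auto simp: H'_def)
  have post: "chain_inv j R' H'" if "env R'" "R' 18 = j" "R' 26 = ?a + 3" "R' 27 = Suc i" for R'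
    unfolding chain_inv_def
  proof (intro conjI exI[of _ "Suc i"])
    show "header H'" using inv unfolding header_def by (simp add: H'2)
    show "\<forall>d<m. stores_arc H' (4 + 3 * d) (tr_arc (ds ! d))"
      using inv by (simp add: stores_arc_def H'2)
    show "\<forall>q<n. stores_arc H' (4 + 3 * m + 3 * q) (fin_arc q)"
      using inv by (simp add: stores_arc_def H'2)
    show "\<forall>i<l. stores_arc H' (4 + 3 * m + 3 * (n + i)) (str_arc i)"
      using inv by (simp add: stores_arc_def H'2)
    show "\<forall>v<Suc i. stores_arc H' (?c + 3 * v) (chain_arc v)"
      using i(5) H'1 by (simp add: less_Suc_eq stores_arc_def H'2)
  qed (use i that in \<open>auto simp: H'2\<close>)
  have "?a + 3 < B" "Suc i < B" "j < B"
    using i(1) size_bounds B unfolding distrib_left by linarith+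
  moreover have "Suc i mod K \<le> Suc i" by simp
  ultimately have "?a + 3 < B" "Suc i < B" "j < B" "Suc i mod K < B" by linarith+
  then show "wp B chain_body (chain_inv j) R H"
    using inv(1) i(2-4) B post unfolding H'_def
    by (simp add: env_def chain_body_def add.assoc)
qed

lemma run_setup: "run B \<omega> setup_prog (\<lambda>_. 0) (memory nfa_word) (cost setup_prog) (tr_inv m)"
proof (rule run_wp)
  let ?H = "memory nfa_word"
  define H' where "H' = ?H(0 := V, 1 := E, 2 := initial M * K, 3 := n * K + (k + 1))"
  have H': "H' b = ?H b" if "4 \<le> b" for b
    using that by (auto simp: H'_def)
  have post: "tr_inv m R' H'" if "env R'" "R' 18 = m" "R' 17 = 4" for R'
    unfolding tr_inv_def
  proof (intro conjI exI[of _ 0])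
    show "\<forall>d<m. 0 \<le> d \<longrightarrow> reads H' (5 + 3 * d) (case ds ! d of (q, a, q') \<Rightarrow> [q, a, q'])"
      using memory_nfa_word(6) by (auto simp: H' split: prod.splits)
  qed (use memory_nfa_word(7-) that in \<open>auto simp: H' header_def, auto simp: H'_def\<close>)
  have V: "(n + l + 1) * K = V" by (simp add: V_def)
  have E: "V - 1 + m + (n + l) = E" by (simp add: E_def)
  have e: "n * K + K - 1 = n * K + (k + 1)" by (simp add: K_def)
  have K: "k + 2 = K" by (simp add: K_def)
  have "k + 2 < B" "n + l + 1 < B" "V < B" "E < B" "initial M * K < B" "n * K < B" "n * K + K < B" "m < B" "10 < B"
    using size_bounds B vertex_bounds unfolding K by linarith+
  note this[unfolded K]
  moreover have bounds: "V - Suc 0 < B" "V + m - Suc 0 < B" "m < B"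
    using size_bounds B by linarith+
  ultimately show "wp B setup_prog (tr_inv m) (\<lambda>_. 0) ?H"
    using post memory_nfa_word(1-5) V E e K unfolding H'_def
    by (simp add: env_def setup_prog_def add.assoc)
qed

lemma run_str_setup:
  assumes "tr_inv 0 R H"
  shows "run B \<omega> str_setup R H (cost str_setup) (str_inv l)"
proof (rule run_wp)
  have inv: "env R" "header H" "R 17 = 4 + 3 * m"
      "\<forall>d < m. stores_arc H (4 + 3 * d) (tr_arc (ds ! d))"
      "\<forall>q < n. H (5 + 3 * m + q) = of_bool (q \<in> final M)"
      "\<forall>i < l. H (5 + 3 * m + n + i) = x ! i" "\<forall>a \<ge> 5 + 3 * m + n + l. H a = 0"
    using assms unfolding tr_inv_def by auto
  have post: "str_inv l R' H" if "env R'" "R' 18 = l" "R' 17 = 4 + 3 * m" "R' 25 = 5 + 3 * m + n + l"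
      "R' 26 = 4 + 3 * m + 3 * (n + l)" "R' 27 = (n + l) * K + (k + 1)" for R'
    \<comment> \<open>The initial state makes \<open>n\<close> positive, so the expanded region ends
      no earlier than the input and the memory behind it is still zero.\<close>
    using that inv initial_bound by (auto simp: str_inv_def)
  have "5 + 3 * m + n + l < B" "4 + 3 * m + 3 * n + 3 * l < B" "V - 1 < B"
    using size_bounds B by linarith+
  then show "wp B str_setup (str_inv l) R H"
    using inv(1,3) last_vertex post by (simp add: env_def str_setup_def add_ac)
qed

lemma run_fin_setup:
  assumes "str_inv 0 R H"
  shows "run B \<omega> fin_setup R H (cost fin_setup) (fin_inv n)"
proof (rule run_wp)
  note inv = assms[unfolded str_inv_def]
  have post: "fin_inv n R' H" if "env R'" "R' 18 = n" "R' 17 = 4 + 3 * m" "R' 25 = 5 + 3 * m + n"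
      "R' 26 = 4 + 3 * m + 3 * n" "R' 27 = n * K" for R'
    using that inv by (auto simp: fin_inv_def)
  have "n * K < B" "n < B" using size_bounds B by linarith+
  then show "wp B fin_setup (fin_inv n) R H"
    using inv post by (simp add: env_def fin_setup_def)
qed

lemma run_chain_setup:
  assumes "fin_inv 0 R H"
  shows "run B \<omega> chain_setup R H (cost chain_setup) (chain_inv (V - 1))"
proof (rule run_wp)
  note inv = assms[unfolded fin_inv_def]
  have post: "chain_inv (V - 1) R' H" if "env R'" "R' 18 = V - 1" "R' 26 = 4 + 3 * m + 3 * (n + l)"
      "R' 27 = 0" for R'
    using that inv by (auto simp: chain_inv_def)
  have "4 + 3 * m + 3 * n + 3 * l < B" "V - 1 < B"
    using size_bounds B by linarith+
  then show "wp B chain_setup (chain_inv (V - 1)) R H"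
    using inv post by (simp add: env_def chain_setup_def add_ac)
qed


lemma run_clear:
  assumes "chain_inv 0 R H"
  shows "run B \<omega> (clear 29) R H (cost (clear 29)) (\<lambda>R H. R = (\<lambda>_. 0) \<and> H = memory cfl_instance)"
proof (rule run_wp)
  have inv: "env R" "header H" "\<forall>d < m. stores_arc H (4 + 3 * d) (tr_arc (ds ! d))"
     "\<forall>q < n. stores_arc H (4 + 3 * m + 3 * q) (fin_arc q)"
     "\<forall>i < l. stores_arc H (4 + 3 * m + 3 * (n + i)) (str_arc i)"
     "\<forall>v < V - 1. stores_arc H (4 + 3 * m + 3 * (n + l) + 3 * v) (chain_arc v)"
     "\<forall>a \<ge> 4 + 3 * m + 3 * (n + l) + 3 * (V - 1). H a = 0"
    using assms unfolding chain_inv_def by auto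
  have 3: "length (case d of (q, a, q') \<Rightarrow> [q, q', a]) = 3" for d :: "nat \<times> nat \<times> nat"
    by (simp split: prod.split)
  have "H = memory cfl_instance"
  proof (rule eq_memory)
    have "reads H 4 (concat (map (\<lambda>(u, a, v). [u, v, a]) arc_list))"
      unfolding arc_list_def map_append concat_append reads_append
        length_concat_const[of "\<lambda>(q, a, q'). [q, q', a]" 3, OF 3]
        reads_concat[of "\<lambda>(q, a, q'). [q, q', a]" 3, OF 3] stores_arc_iff_reads[symmetric]
      using inv(3-6) by (simp add: add.assoc distrib_left)
    then show "reads H 0 cfl_instance"
      using inv(2) length_arc_list by (simp add: cfl_instance_def header_def numeral_eq_Suc)
    have "length cfl_instance = 4 + 3 * E"
      by (simp add: cfl_instance_def length_arc_list length_concat_const[of "\<lambda>(q, a, q'). [q, q', a]" 3, OF 3])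
    then show "\<forall>a \<ge> length cfl_instance. H a = 0"
      using inv(7) by (simp add: E_def)
  qed
  moreover have "(\<lambda>i. if i \<in> set (0 # [1..<29]) then 0 else R i) = (\<lambda>_. 0)"
    using inv(1) by (auto simp: env_def not_less)
  ultimately show "wp B (clear 29) (\<lambda>R H. R = (\<lambda>_. 0) \<and> H = memory cfl_instance) R H"
    unfolding clear_def using B by (subst wp_clear) auto
qed

text \<open>The constants are generous: every loop body has fewer than 15 instructions, and
  everything outside the loops takes fewer than 200 steps.\<close>

lemma run_reduction:
  "run B \<omega> reduction_prog (\<lambda>_. 0) (memory nfa_word) (50 * (m + l + n + V) + 200)
    (\<lambda>R H. R = (\<lambda>_. 0) \<and> H = memory cfl_instance)"
proof -
  have nz: "R 18 \<noteq> 0" if "tr_inv (Suc j) R H \<or> str_inv (Suc j) R H \<or> fin_inv (Suc j) R H \<or> chain_inv (Suc j) R H" for j R H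
    using that by (auto simp: tr_inv_def str_inv_def fin_inv_def chain_inv_def)
  have z: "R 18 = 0" if "tr_inv 0 R H \<or> str_inv 0 R H \<or> fin_inv 0 R H \<or> chain_inv 0 R H" for R H
    using that by (auto simp: tr_inv_def str_inv_def fin_inv_def chain_inv_def)
  have tr: "run B \<omega> (WhileNZ 18 tr_body) R H (j * (cost tr_body + 1) + 1) (tr_inv 0)"
    if "tr_inv j R H" for j R H
    using that by (rule run_WhileNZ[where I = tr_inv, rotated 2]) (use nz z run_tr_body in blast)+
  have str: "run B \<omega> (WhileNZ 18 str_body) R H (j * (cost str_body + 1) + 1) (str_inv 0)"
    if "str_inv j R H" for j R H
    using that by (rule run_WhileNZ[where I = str_inv, rotated 2]) (use nz z run_str_body in blast)+
  have fin: "run B \<omega> (WhileNZ 18 fin_body) R H (j * (cost fin_body + 1) + 1) (fin_inv 0)"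
    if "fin_inv j R H" for j R H
    using that by (rule run_WhileNZ[where I = fin_inv, rotated 2]) (use nz z run_fin_body in blast)+
  have chain: "run B \<omega> (WhileNZ 18 chain_body) R H (j * (cost chain_body + 1) + 1) (chain_inv 0)"
    if "chain_inv j R H" for j R H
    using that by (rule run_WhileNZ[where I = chain_inv, rotated 2]) (use nz z run_chain_body in blast)+
  have c: "cost (block (Const r 0) (map (\<lambda>i. Const i 0) rs)) = Suc (length rs)" for r rs
    by (induction rs arbitrary: r) auto
  have "run B \<omega> reduction_prog (\<lambda>_. 0) (memory nfa_word)
    (cost setup_prog + ((m * (cost tr_body + 1) + 1) + (cost str_setup + ((l * (cost str_body + 1) + 1) +
     (cost fin_setup + ((n * (cost fin_body + 1) + 1) + (cost chain_setup +
     (((V - 1) * (cost chain_body + 1) + 1) + cost (clear 29)))))))))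
    (\<lambda>R H. R = (\<lambda>_. 0) \<and> H = memory cfl_instance)"
    unfolding reduction_prog_def block.simps
    by (rule run_Seq run_setup tr str fin chain run_str_setup run_fin_setup run_chain_setup run_clear | assumption)+
  then show ?thesis
  proof (rule run_mono)
    show "cost setup_prog + ((m * (cost tr_body + 1) + 1) + (cost str_setup + ((l * (cost str_body + 1) + 1) +
       (cost fin_setup + ((n * (cost fin_body + 1) + 1) + (cost chain_setup +
       (((V - 1) * (cost chain_body + 1) + 1) + cost (clear 29)))))))) \<le> 50 * (m + l + n + V) + 200"
      by (simp add: setup_prog_def tr_body_def str_setup_def str_body_def fin_setup_def fin_body_def
        chain_setup_def chain_body_def clear_def c)
  qed
qed

end

end

section \<open>The reduction as a decision procedure\<close>

lemma exec_Seq_iff: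
  assumes "exec B p s t1 s1"
  shows "exec B (Seq p q) s t s' \<longleftrightarrow> (\<exists>t2. exec B q s1 t2 s' \<and> t = t1 + t2)"
proof
  assume "exec B (Seq p q) s t s'"
  then show "\<exists>t2. exec B q s1 t2 s' \<and> t = t1 + t2"
    by (rule exec_elims(6)) (use exec_deterministic[OF assms] in blast)
qed (use assms exec.Seq in blast)

text \<open>The reduction passes the coin stream on unchanged, so for every stream the composed
  program ends as \<open>p\<close> does. The success events are equal as sets, and the probability
  carries over.\<close>

lemma decides_within_Seq:
  assumes dec: "decides_within p c w' answer T"
    and le: "capacity c w' \<le> capacity c' w"
    and r: "\<And>\<omega>. \<exists>t. exec (capacity c' w) r (initial_machine w \<omega>) t (initial_machine w' \<omega>) \<and> t \<le> U"
  shows "decides_within (Seq r p) c' w answer (U + T)"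
proof -
  let ?B = "capacity c w'" and ?B' = "capacity c' w"
  have halt: "\<exists>t s. exec ?B p (initial_machine w' \<omega>) t s \<and> t \<le> T" for \<omega>
    using dec by (auto simp: decides_within_def)
  \<comment> \<open>Monotonicity transfers the halting run to the larger capacity, and determinism
    excludes any other run there.\<close>
  have p: "exec ?B' p (initial_machine w' \<omega>) t s \<longleftrightarrow> exec ?B p (initial_machine w' \<omega>) t s" for \<omega> t s
    using halt[of \<omega>] exec_mono[OF _ le] exec_deterministic by metis
  have seq: "\<exists>t1 \<le> U. \<forall>t s. exec ?B' (Seq r p) (initial_machine w \<omega>) t s \<longleftrightarrow>
      (\<exists>t2. exec ?B p (initial_machine w' \<omega>) t2 s \<and> t = t1 + t2)" for \<omega>
    using r[of \<omega>] exec_Seq_iff unfolding p[symmetric] by blast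
  have "\<exists>t s. exec ?B' (Seq r p) (initial_machine w \<omega>) t s \<and> t \<le> U + T" for \<omega>
  proof -
    obtain t1 where "t1 \<le> U" "\<And>t s. exec ?B' (Seq r p) (initial_machine w \<omega>) t s \<longleftrightarrow>
        (\<exists>t2. exec ?B p (initial_machine w' \<omega>) t2 s \<and> t = t1 + t2)"
      using seq by blast
    with halt[of \<omega>] show ?thesis by (metis add_mono)
  qed
  moreover have "{\<omega>. \<exists>t s. exec ?B' (Seq r p) (initial_machine w \<omega>) t s \<and> (regs s 0 \<noteq> 0 \<longleftrightarrow> answer)} =
      {\<omega>. \<exists>t s. exec ?B p (initial_machine w' \<omega>) t s \<and> (regs s 0 \<noteq> 0 \<longleftrightarrow> answer)}"
    using seq by (intro Collect_cong) blast
  ultimately show ?thesis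
    using dec by (simp add: decides_within_def)
qed

context nfa_instance
begin

text \<open>\<open>W\<close> is the capacity base of the NFA word. The capacity base of the graph
  instance is at most \<open>6 * (W * W)\<close>, hence below \<open>W ^ 4\<close>, so exponent
  \<open>c\<close> becomes \<open>4 * c\<close>. The additional 4 leaves room for the reduction
  itself, even if \<open>c = 0\<close>.\<close>

lemma capacity_bounds:
  "V + 3 * E + 10 < capacity (4 * (c + 1)) nfa_word"
  "capacity c cfl_instance \<le> capacity (4 * (c + 1)) nfa_word"
proof -
  define W where "W = 2 + length nfa_word + Max (set nfa_word)"
  \<comment> \<open>The alphabet size is bounded by the largest entry of the word; the length does
    not control it.\<close>
  have "k \<in> set nfa_word" by (simp add: nfa_word_def)
  then have "k \<le> Max (set nfa_word)" by simp
  then have W: "k + 2 \<le> W" "n + l + 1 \<le> W" "m + n + l \<le> W" "7 \<le> W"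
    unfolding W_def length_nfa_word by linarith+
  have V: "V \<le> W * W"
    unfolding V_def K_def by (intro mult_mono W) auto
  have E: "E \<le> W * W + W" using V W unfolding E_def by linarith
  have "4 * W + 10 \<le> 7 * W" "7 * W \<le> W * W" using W by auto
  then have "V + 4 * E + 10 \<le> 6 * (W * W)" using V E by linarith
  also have "\<dots> < (W * W) * (W * W)"
  proof -
    have "7 * 7 \<le> W * W" using W by (intro mult_mono) auto
    then show ?thesis using W by (intro mult_strict_right_mono) auto
  qed
  also have "\<dots> = W ^ 4" by (simp add: eval_nat_numeral)
  finally have Z: "V + 4 * E + 10 < W ^ 4" .
  have "W ^ 4 \<le> W ^ (4 * (c + 1))" using W by (intro power_increasing) auto
  then show "V + 3 * E + 10 < capacity (4 * (c + 1)) nfa_word"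
    using Z unfolding capacity_def W_def[symmetric] by linarith
  have "Max (set cfl_instance) \<le> V + E + 4"
  proof (rule Max.boundedI)
    fix a assume "a \<in> set cfl_instance"
    then show "a \<le> V + E + 4"
      using vertex_bounds arc_list_bound unfolding cfl_instance_def length_arc_list
      by (fastforce dest: less_imp_le)
  qed (auto simp: cfl_instance_def)
  moreover have "length cfl_instance = 4 + 3 * E"
    unfolding cfl_instance_def length_append
    by (subst length_concat_const[where c = 3]) (auto simp: length_arc_list)
  ultimately have "2 + length cfl_instance + Max (set cfl_instance) \<le> W ^ 4"
    using Z by linarith
  then have "capacity c cfl_instance \<le> (W ^ 4) ^ c"
    unfolding capacity_def by (intro power_mono) auto
  also have "\<dots> = W ^ (4 * c)" by (simp add: power_mult)
  also have "\<dots> \<le> W ^ (4 * (c + 1))" using W by (intro power_increasing) auto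
  finally show "capacity c cfl_instance \<le> capacity (4 * (c + 1)) nfa_word"
    by (simp add: capacity_def W_def)
qed

lemma decides_within_reduction:
  assumes "decides_within p c cfl_instance answer T"
  shows "decides_within (Seq reduction_prog p) (4 * (c + 1)) nfa_word answer
    (50 * (m + l + n + V) + 200 + T)"
proof (rule decides_within_Seq[OF assms capacity_bounds(2)])
  fix \<omega>
  show "\<exists>t. exec (capacity (4 * (c + 1)) nfa_word) reduction_prog (initial_machine nfa_word \<omega>) t
      (initial_machine cfl_instance \<omega>) \<and> t \<le> 50 * (m + l + n + V) + 200"
    using run_reduction[OF capacity_bounds(1), of c \<omega>] by (auto simp: run_def initial_machine_eq)
qed

end

text \<open>As \<open>m\<close>, \<open>k\<close> and \<open>l\<close> are functions of
  \<open>n\<close>, all instances of size \<open>n\<close> give graphs with the same number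
  \<open>N\<close> of vertices, and the time bound depends on \<open>n\<close> alone.\<close>

lemma nfa_acceptance_reduces:
  assumes T: "\<forall>i. \<forall>(w, answer) \<in> cfl_reachability palindrome_cfg i. decides_within p c w answer (T i)"
    and w: "(w, answer) \<in> nfa_acceptance m k l n"
  defines "N \<equiv> (n + l n + 1) * (k n + 2)"
  shows "decides_within (Seq reduction_prog p) (4 * (c + 1)) w answer
    (50 * (m n + l n + n + N) + 200 + T N)"
proof -
  from w obtain M x where M: "answer = accepts M x" "wf_nfa M" "states M = {..<n}" "alphabet M = {..<k n}"
    "card (transitions M) = m n" "x \<in> lists (alphabet M)" "length x = l n" "nfa_encoding M x w"
    unfolding nfa_acceptance_def by blast
  from M(8) obtain dl where dl: "distinct dl" "set dl = transitions M"
    "w = [card (states M), card (alphabet M), initial M, length dl, length x]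
            @ concat (map (\<lambda>(q, a, q'). [q, a, q']) dl)
            @ map (\<lambda>q. of_bool (q \<in> final M)) [0..<card (states M)] @ x"
    unfolding nfa_encoding_def by blast
  interpret nfa_instance M dl x n "k n"
    using M dl by unfold_locales auto
  have "w = nfa_word" using dl(3) M(3,4) by (simp add: nfa_word_def)
  moreover have "length dl = m n" using dl M(5) distinct_card by metis
  moreover have "V = N"
    by (simp add: V_def K_def N_def M(7))
  moreover have "decides_within p c cfl_instance answer (T V)"
    using T cfl_instance_in_cfl_reachability M(1) by blast
  ultimately show ?thesis
    using decides_within_reduction[of p c answer] M(7) by simp
qed

section \<open>Running times\<close>

text \<open>An exponent tending to 0 is eventually below any fixed \<eta>, so unary letters cost at
  most a factor of order \<open>n powr \<eta>\<close>.\<close>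

lemma vertex_count_bigo:
  fixes k l :: "nat \<Rightarrow> nat" and \<eta> :: real
  assumes l: "(\<lambda>n. real (l n)) \<in> \<Theta>(\<lambda>n. real n powr 1)" and \<eta>: "\<eta> > 0"
    and k: "\<exists>h \<in> o(\<lambda>_. 1). \<forall>\<^sub>F n in at_top. real (k n) = real n powr h n"
  shows "(\<lambda>n. real ((n + l n + 1) * (k n + 2))) \<in> O(\<lambda>n. real n powr (1 + \<eta>))"
proof -
  have "(\<lambda>n. real (l n)) \<in> O(\<lambda>n. real n)"
    using bigthetaD1[OF l] by simp
  then have 1: "(\<lambda>n. real n + real (l n) + 1) \<in> O(\<lambda>n. real n)"
  proof (intro sum_in_bigo)
    show "(\<lambda>_. 1) \<in> O(\<lambda>n. real n)"
      by (intro bigoI[of _ 1] eventually_mono[OF eventually_ge_at_top[of 1]]) auto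
  qed auto
  from k obtain h where h: "h \<in> o(\<lambda>_. 1 :: real)" "\<forall>\<^sub>F n in at_top. real (k n) = real n powr h n" by blast
  have "(h \<longlongrightarrow> 0) at_top" using smalloD_tendsto[OF h(1)] by simp
  then have "\<forall>\<^sub>F n in at_top. h n < \<eta>" using \<eta> by (rule order_tendstoD)
  with h(2) eventually_ge_at_top[of 1] have "\<forall>\<^sub>F n in at_top. real (k n) + 2 \<le> 3 * real n powr \<eta>"
  proof eventually_elim
    case (elim n)
    have "real n powr h n \<le> real n powr \<eta>" using elim by (intro powr_mono) auto
    moreover have "1 \<le> real n powr \<eta>" using elim \<eta> by (intro ge_one_powr_ge_zero) auto
    ultimately show ?case using elim by linarith
  qed
  then have "(\<lambda>n. real (k n) + 2) \<in> O(\<lambda>n. real n powr \<eta>)"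
    by (intro bigoI[of _ 3]) (auto elim!: eventually_mono)
  with 1 have "(\<lambda>n. (real n + real (l n) + 1) * (real (k n) + 2)) \<in> O(\<lambda>n. real n * real n powr \<eta>)"
    by (rule landau_o.big.mult)
  also have "(\<lambda>n. real n * real n powr \<eta>) \<in> O(\<lambda>n. real n powr (1 + \<eta>))"
    by (intro bigoI[of _ 1] always_eventually) (auto simp: powr_add powr_one' abs_mult)
  finally show ?thesis by (simp add: algebra_simps)
qed

lemma bigo_powr_mono: "a \<le> b \<Longrightarrow> (\<lambda>n. real n powr a) \<in> O(\<lambda>n. real n powr b)"
  by (intro bigoI[of _ 1] eventually_mono[OF eventually_ge_at_top[of 1]]) (auto intro: powr_mono)

text \<open>The unary blow-up is allowed to spend half of the saving: the exponent becomes
  \<open>3 - \<delta> / 2\<close>, which is 3 times \<open>1 - \<delta> / 6\<close>, and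
  \<open>m * l\<close> has order \<open>n ^ 3\<close>. The bound \<delta> \<le> 1 keeps this
  exponent above 2, so that handling the \<open>m\<close> transitions fits.\<close>

lemma reduction_time_bigo:
  fixes k l m T :: "nat \<Rightarrow> nat" and \<delta> :: real
  defines "V \<equiv> \<lambda>n. (n + l n + 1) * (k n + 2)"
  assumes \<delta>: "0 < \<delta>" "\<delta> \<le> 1"
    and m: "(\<lambda>n. real (m n)) \<in> \<Theta>(\<lambda>n. real n powr 2)"
    and l: "(\<lambda>n. real (l n)) \<in> \<Theta>(\<lambda>n. real n powr 1)"
    and k: "\<exists>h \<in> o(\<lambda>_. 1). \<forall>\<^sub>F n in at_top. real (k n) = real n powr h n"
    and T: "(\<lambda>n. real (T n)) \<in> O(\<lambda>n. real n powr (3 - \<delta>))"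
  shows "(\<lambda>n. real (50 * (m n + l n + n + V n) + 200 + T (V n)))
    \<in> O(\<lambda>n. (real (m n) * real (l n)) powr (1 - \<delta> / 6))"
proof -
  let ?g = "\<lambda>n. real n powr (3 - \<delta> / 2)"
  have V: "(\<lambda>n. real (V n)) \<in> O(\<lambda>n. real n powr (1 + \<delta> / 6))"
    unfolding V_def using \<delta> by (intro vertex_count_bigo[OF l _ k]) simp
  \<comment> \<open>The bound on \<open>T\<close> is asymptotic, so it can be applied at
    \<open>V n\<close> only because \<open>V n\<close> tends to infinity.\<close>
  have "n \<le> V n" for n
  proof -
    have "n * 1 \<le> V n" unfolding V_def by (intro mult_mono) auto
    then show ?thesis by simp
  qed
  then have lim: "filterlim V at_top at_top"
    by (intro filterlim_at_top_mono[OF filterlim_ident]) auto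
  have "(\<lambda>n. real (T (V n))) \<in> O(\<lambda>n. real (V n) powr (3 - \<delta>))"
    using landau_o.big.compose[OF T lim] .
  also have "(\<lambda>n. real (V n) powr (3 - \<delta>)) \<in> O(\<lambda>n. (real n powr (1 + \<delta> / 6)) powr (3 - \<delta>))"
    using \<delta> by (intro bigo_powr_nonneg V) auto
  also have "(\<lambda>n. (real n powr (1 + \<delta> / 6)) powr (3 - \<delta>)) = (\<lambda>n. real n powr ((1 + \<delta> / 6) * (3 - \<delta>)))"
    by (simp add: powr_powr)
  also have "\<dots> \<in> O(?g)"
  proof (rule bigo_powr_mono)
    \<comment> \<open>The product equals
      \<open>3 - \<delta> / 2 - \<delta> * \<delta> / 6\<close>.\<close>
    have "0 \<le> \<delta> * \<delta>" by simp
    then show "(1 + \<delta> / 6) * (3 - \<delta>) \<le> 3 - \<delta> / 2" by (simp add: algebra_simps)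
  qed
  finally have TV: "(\<lambda>n. real (T (V n))) \<in> O(?g)" .
  have "(\<lambda>n. real (m n)) \<in> O(?g)"
    using bigthetaD1[OF m] bigo_powr_mono[of 2 "3 - \<delta> / 2"] \<delta> landau_o.big_trans by fastforce
  moreover have "(\<lambda>n. real (l n)) \<in> O(?g)"
    using landau_o.big_trans[OF bigthetaD1[OF l] bigo_powr_mono[of 1 "3 - \<delta> / 2"]] \<delta> by simp
  moreover have "(\<lambda>n. real (V n)) \<in> O(?g)"
    using landau_o.big_trans[OF V bigo_powr_mono[of "1 + \<delta> / 6" "3 - \<delta> / 2"]] \<delta> by simp
  moreover have "(\<lambda>n. real n) \<in> O(?g)"
    using bigo_powr_mono[of 1 "3 - \<delta> / 2"] \<delta> by simp
  moreover have "(\<lambda>_. 200 :: real) \<in> O(?g)"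
  proof -
    have "(\<lambda>n. real n powr 0) \<in> O(?g)" using \<delta> by (intro bigo_powr_mono) simp
    moreover have "(\<lambda>_. 200 :: real) \<in> O(\<lambda>n. real n powr 0)"
      by (intro bigoI[of _ 200] eventually_mono[OF eventually_gt_at_top[of 0]]) auto
    ultimately show ?thesis using landau_o.big_trans by blast
  qed
  ultimately have "(\<lambda>n. 50 * (real (m n) + real (l n) + real n + real (V n)) + 200 + real (T (V n))) \<in> O(?g)"
    using TV by (intro sum_in_bigo) (simp_all add: sum_in_bigo)
  also have "?g \<in> O(\<lambda>n. (real (m n) * real (l n)) powr (1 - \<delta> / 6))"
  proof -
    \<comment> \<open>This is where the lower bounds contained in the \<Theta>-assumptions on
      \<open>m\<close> and \<open>l\<close> enter.\<close>
    have "(\<lambda>n. real n powr 2 * real n powr 1) \<in> O(\<lambda>n. real (m n) * real (l n))"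
      using landau_o.big.mult[OF bigthetaD1[OF bigtheta_sym[THEN iffD1, OF m]] bigthetaD1[OF bigtheta_sym[THEN iffD1, OF l]]] .
    then have "(\<lambda>n. (real n powr 2 * real n powr 1) powr (1 - \<delta> / 6)) \<in>
        O(\<lambda>n. (real (m n) * real (l n)) powr (1 - \<delta> / 6))"
      using \<delta> by (intro bigo_powr_nonneg) auto
    also have "(\<lambda>n. (real n powr 2 * real n powr 1) powr (1 - \<delta> / 6)) = ?g"
    proof
      fix n
      show "(real n powr 2 * real n powr 1) powr (1 - \<delta> / 6) = ?g n"
        unfolding powr_add[symmetric] powr_powr
        by (rule arg_cong[of _ _ "(powr) (real n)"]) (simp add: field_simps)
    qed
    finally show ?thesis .
  qed
  finally show ?thesis by simp
qed

theorem theorem3p1: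
  assumes nfa_acceptance_hypothesis
  shows "\<exists>\<Gamma> :: (nat, nat) cfg. wf_cfg \<Gamma> \<and>
    (\<forall>\<epsilon> :: real. \<epsilon> > 0 \<longrightarrow>
      \<not> (\<exists>p c. solves_in_time p c (cfl_reachability \<Gamma>) (\<lambda>n. real n powr (3 - \<epsilon>))))"
proof (intro exI[of _ palindrome_cfg] conjI allI impI notI wf_palindrome_cfg)
  fix \<epsilon> :: real
  assume \<epsilon>: "\<epsilon> > 0"
    and "\<exists>p c. solves_in_time p c (cfl_reachability palindrome_cfg) (\<lambda>n. real n powr (3 - \<epsilon>))"
  then obtain p c T where T: "(\<lambda>n. real (T n)) \<in> O(\<lambda>n. real n powr (3 - \<epsilon>))"
    "\<forall>N. \<forall>(w, answer) \<in> cfl_reachability palindrome_cfg N. decides_within p c w answer (T N)"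
    unfolding solves_in_time_def by blast
  \<comment> \<open>For \<epsilon> > 1 the claimed exponent is weakened to 2, which keeps \<delta>
    in the range that the time analysis assumes.\<close>
  define \<delta> where "\<delta> = min \<epsilon> 1"
  have \<delta>: "0 < \<delta>" "\<delta> \<le> 1" "\<delta> \<le> \<epsilon>" using \<epsilon> by (auto simp: \<delta>_def)
  have T': "(\<lambda>n. real (T n)) \<in> O(\<lambda>n. real n powr (3 - \<delta>))"
    using landau_o.big_trans[OF T(1) bigo_powr_mono[of "3 - \<epsilon>" "3 - \<delta>"]] \<delta> by simp
  have "solves_in_time (Seq reduction_prog p) (4 * (c + 1)) (nfa_acceptance m k l)
      (\<lambda>n. (real (m n) * real (l n)) powr (1 - \<delta> / 6))"
    if "(\<lambda>n. real (m n)) \<in> \<Theta>(\<lambda>n. real n powr 2)" "(\<lambda>n. real (l n)) \<in> \<Theta>(\<lambda>n. real n powr 1)"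
      "\<exists>h \<in> o(\<lambda>_. 1). \<forall>\<^sub>F n in at_top. real (k n) = real n powr h n" for m k l :: "nat \<Rightarrow> nat"
    unfolding solves_in_time_def
    by (rule exI, rule conjI, rule reduction_time_bigo[OF \<delta>(1,2) that T'])
      (use nfa_acceptance_reduces[OF T(2)] in blast)
  moreover have "1 \<le> (2 :: real)" "(2 :: real) \<le> 2" "(1 :: real) > 0" "\<delta> / 6 > 0" using \<delta> by auto
  ultimately show False
    using assms unfolding nfa_acceptance_hypothesis_def by blast
qed

end
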